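(* Let $b\ge 0$, $x<b$, $n\in\mathbb{N}$ and $y\ge 0$, and write $\tau=\tau_b=\inf\{k\in\mathbb{N}_0: X_k\ge b\}$. Then $$P_x(X_\tau-b\le y,\ \tau=n)=\sum_{i\in E}H_{e_i}(y)\,P_x(\tau=n,\,G_i).$$
   Context: $\mathbb{N}=\{1,2,\dots\}$, $\mathbb{N}_0=\mathbb{N}\cup\{0\}$. Phasetype distributions: let $m\in\mathbb{N}$, $E=\{1,\dots,m\}$, $\Delta=m+1$, and consider continuous-time Markov chains on $E\cup\{\Delta\}$ in which $1,\dots,m$ are transient and $\Delta$ is absorbing, with generator $\hat Q=\begin{pmatrix}Q&-Q\mathbf 1\\0&0\end{pmatrix}$, where $Q$ is an $m\times m$ matrix and $\mathbf 1$ is the all-ones column vector. For a probability row vector $\alpha=(\alpha_1,\dots,\alpha_m)$, $PH(Q,\alpha)$ denotes the distribution of the absorption time $\eta=\inf\{t\ge0:J_t=\Delta\}$ of such a chain $(J_t)$ started with initial distribution $(\alpha,0)$, and $H_\alpha$ denotes its distribution function, $H_\alpha(s)=1-\alpha e^{Qs}\mathbf 1$, $s\ge 0$. $e_i$ is the $i$-th unit (row) vector, so $H_{e_i}$ is the distribution function of $PH(Q,e_i)$. Process: let $0<\lambda<1$ and $X_n=\lambda X_{n-1}+Z_n$, $n\in\mathbb{N}$, where the innovations $Z_n=S_n-T_n$ are i.i.d., $S_n,T_n\ge 0$ are independent, $S_n$ is $PH(Q,\alpha)$-distributed and $T_n$ has an arbitrary distribution on $[0,\infty)$. $P_x$ denotes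 the probability measure under which $X_0=x$. For each $n$ let $S_n$ be realized as the absorption time of a Markov chain $(J^{(n)}_t)_{t\ge0}$ with generator $\hat Q$ and initial distribution $(\alpha,0)$; the chains $J^{(n)}$, $n\in\mathbb{N}$, and the variables $T_n$, $n\in\mathbb{N}$, are all independent, the $J^{(n)}$ being identically distributed and the $T_n$ being identically distributed. Embedding: for $t\ge0$ put $n_t=\max\{n\in\mathbb{N}_0:\sum_{k=1}^nS_k\le t\}$, $$J_t=J^{(n_t+1)}_{t-\sum_{k=1}^{n_t}S_k},\qquad Y_t=\lambda X_{n_t}-T_{n_t+1}+t-\sum_{k=1}^{n_t}S_k,$$ $\hat\tau=\inf\{t\ge0:Y_t\ge b\}$, and $G_i=\{\hat\tau<\infty,\ J_{\hat\tau}=i\}$ for $i\in E$. *)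

theory Defs
  imports "HOL-Probability.Probability"
begin

section \<open>Continuous-time Markov chains with finite state space\<close>

text \<open>
  The product \<open>*\<close> that HOL-Analysis puts on vectors is componentwise, so
  the library's \<open>exp\<close> is not available for matrices, whose product is \<open>**\<close>.
\<close>

definition mat_exp :: "real ^ 's ^ 's \<Rightarrow> real ^ 's::finite ^ 's" where
  "mat_exp A = (\<Sum>k. (1 / fact k) *\<^sub>R (((**) A) ^^ k) (mat 1))"

definition is_generator :: "real ^ 's ^ 's::finite \<Rightarrow> bool" where
  "is_generator A \<longleftrightarrow>
     (\<forall>i j. i \<noteq> j \<longrightarrow> 0 \<le> A $ i $ j) \<and> (\<forall>i. (\<Sum>j\<in>UNIV. A $ i $ j) = 0)"

text \<open>
  A Markov chain with generator \<open>A\<close> and initial distribution \<open>p\<close>: its finite-dimensional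
  distributions are those given by the transition matrices \<open>exp (t A)\<close>, and almost all
  of its paths are right-continuous for the discrete topology on the state space. The time
  parameter ranges over \<open>t \<ge> 0\<close>; values at negative times are irrelevant.
\<close>

definition markov_chain ::
  "'w measure \<Rightarrow> real ^ 's ^ 's::finite \<Rightarrow> real ^ 's \<Rightarrow> (real \<Rightarrow> 'w \<Rightarrow> 's) \<Rightarrow> bool" where
  "markov_chain M A p J \<longleftrightarrow>
     (\<forall>t\<ge>0. J t \<in> measurable M (count_space UNIV)) \<and>
     (\<forall>k (t :: nat \<Rightarrow> real) (s :: nat \<Rightarrow> 's).
        t 0 = 0 \<and> (\<forall>l<k. t l \<le> t (Suc l)) \<longrightarrow>
        measure M {\<omega> \<in> space M. \<forall>l\<le>k. J (t l) \<omega> = s l} =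
          p $ s 0 * (\<Prod>l<k. mat_exp ((t (Suc l) - t l) *\<^sub>R A) $ s l $ s (Suc l))) \<and>
     (AE \<omega> in M. \<forall>t\<ge>0. \<forall>\<^sub>F u in at_right t. J u \<omega> = J t \<omega>)"

text \<open>
  A state \<open>i\<close> is transient if the total time spent in \<open>i\<close> by the chain started in \<open>i\<close> has finite
  expectation; by Tonelli this expectation is the integral of the return probability.
\<close>

definition transient_state :: "real ^ 's ^ 's::finite \<Rightarrow> 's \<Rightarrow> bool" where
  "transient_state A i \<longleftrightarrow>
     (\<integral>\<^sup>+ t \<in> {0..}. ennreal (mat_exp (t *\<^sub>R A) $ i $ i) \<partial>lborel) < \<infinity>"

definition prob_vector :: "real ^ 's::finite \<Rightarrow> bool" where
  "prob_vector p \<longleftrightarrow> (\<forall>i. 0 \<le> p $ i) \<and> (\<Sum>i\<in>UNIV. p $ i) = 1"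


section \<open>Phasetype distributions\<close>

text \<open>
  \<open>E\<close> is (the universe of) a finite type \<open>'m\<close>, and \<open>E \<union> {\<Delta>}\<close> is \<open>'m option\<close>
  with \<open>\<Delta> = None\<close>.
\<close>

definition Q_hat :: "real ^ 'm ^ 'm \<Rightarrow> real ^ 'm option ^ ('m::finite) option" where
  "Q_hat Q = (\<chi> i j. case i of
       None \<Rightarrow> 0
     | Some i' \<Rightarrow> (case j of
           None \<Rightarrow> - (Q *v (\<chi> _. 1)) $ i'
         | Some j' \<Rightarrow> Q $ i' $ j'))"

definition init_ext :: "real ^ 'm \<Rightarrow> real ^ ('m::finite) option" where
  "init_ext \<alpha> = (\<chi> i. case i of None \<Rightarrow> 0 | Some i' \<Rightarrow> \<alpha> $ i')"

definition absorption_time :: "(real \<Rightarrow> 'w \<Rightarrow> 'm option) \<Rightarrow> 'w \<Rightarrow> ereal" where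
  "absorption_time J \<omega> = Inf (ereal ` {t. 0 \<le> t \<and> J t \<omega> = None})"

definition PH_cdf :: "real ^ 'm ^ 'm \<Rightarrow> real ^ 'm::finite \<Rightarrow> real \<Rightarrow> real" where
  "PH_cdf Q \<alpha> s = (if s < 0 then 0 else 1 - (\<alpha> v* mat_exp (s *\<^sub>R Q)) \<bullet> (\<chi> _. 1))"


section \<open>The autoregressive process\<close>

primrec AR_process ::
  "real \<Rightarrow> real \<Rightarrow> (nat \<Rightarrow> 'w \<Rightarrow> real) \<Rightarrow> nat \<Rightarrow> 'w \<Rightarrow> real" where
  "AR_process lam x Z 0 = (\<lambda>\<omega>. x)"
| "AR_process lam x Z (Suc n) = (\<lambda>\<omega>. lam * AR_process lam x Z n \<omega> + Z (Suc n) \<omega>)"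

definition hitting_time :: "real \<Rightarrow> (nat \<Rightarrow> 'w \<Rightarrow> real) \<Rightarrow> 'w \<Rightarrow> enat" where
  "hitting_time b X \<omega> = Inf (enat ` {k. b \<le> X k \<omega>})"

text \<open>
  The \<open>\<sigma>\<close>-algebra on \<open>M\<close> generated by the family consisting of all the chains \<open>J n\<close>
  (index \<open>Inl n\<close>) and all the variables \<open>T n\<close> (index \<open>Inr n\<close>).
\<close>

definition generated_sigma ::
  "'w measure \<Rightarrow> (nat \<Rightarrow> real \<Rightarrow> 'w \<Rightarrow> 's) \<Rightarrow> (nat \<Rightarrow> 'w \<Rightarrow> real) \<Rightarrow> nat + nat \<Rightarrow> 'w set set" where
  "generated_sigma M J T =
     case_sum
       (\<lambda>n. sigma_sets (space M) {J n t -` {s} \<inter> space M | t s. 0 \<le> t})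
       (\<lambda>n. {T n -` B \<inter> space M | B. B \<in> sets borel})"


section \<open>The embedding into continuous time\<close>

definition embed_index :: "(nat \<Rightarrow> 'w \<Rightarrow> real) \<Rightarrow> real \<Rightarrow> 'w \<Rightarrow> nat" where
  "embed_index S t \<omega> = Max {n. (\<Sum>k=1..n. S k \<omega>) \<le> t}"

definition embed_J ::
  "(nat \<Rightarrow> real \<Rightarrow> 'w \<Rightarrow> 's) \<Rightarrow> (nat \<Rightarrow> 'w \<Rightarrow> real) \<Rightarrow> real \<Rightarrow> 'w \<Rightarrow> 's" where
  "embed_J J S t \<omega> =
     (let n = embed_index S t \<omega> in J (n + 1) (t - (\<Sum>k=1..n. S k \<omega>)) \<omega>)"

definition embed_Y ::
  "real \<Rightarrow> (nat \<Rightarrow> 'w \<Rightarrow> real) \<Rightarrow> (nat \<Rightarrow> 'w \<Rightarrow> real) \<Rightarrow> (nat \<Rightarrow> 'w \<Rightarrow> real) \<Rightarrow>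
   real \<Rightarrow> 'w \<Rightarrow> real" where
  "embed_Y lam X S T t \<omega> =
     (let n = embed_index S t \<omega>
      in lam * X n \<omega> - T (n + 1) \<omega> + t - (\<Sum>k=1..n. S k \<omega>))"

definition tau_hat :: "real \<Rightarrow> (real \<Rightarrow> 'w \<Rightarrow> real) \<Rightarrow> 'w \<Rightarrow> ereal" where
  "tau_hat b Y \<omega> = Inf (ereal ` {t. 0 \<le> t \<and> b \<le> Y t \<omega>})"

definition G_event ::
  "'w measure \<Rightarrow> real \<Rightarrow> (real \<Rightarrow> 'w \<Rightarrow> real) \<Rightarrow> (real \<Rightarrow> 'w \<Rightarrow> 'm option) \<Rightarrow> 'm \<Rightarrow> 'w set" where
  "G_event M b Y J i =
     {\<omega> \<in> space M. tau_hat b Y \<omega> < \<infinity> \<and> J (real_of_ereal (tau_hat b Y \<omega>)) \<omega> = Some i}"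

text \<open>
  Quantities such as the absorption time are finite, and path properties hold, only almost
  surely, and on the exceptional null set the definitions above return junk. Probabilities are
  therefore taken in the completion of \<open>M\<close>, which agrees with \<open>M\<close> on all sets measurable
  in \<open>M\<close>, so that events are insensitive to that null set.
\<close>

abbreviation cprob :: "'w measure \<Rightarrow> 'w set \<Rightarrow> real" where
  "cprob M A \<equiv> measure (completion M) A"

end

theory Submission
  imports Defs
begin

text \<open>
  Put \<open>R = b - lam X\<^sub>n\<^sub>-\<^sub>1 + T\<^sub>n\<close> and let \<open>F\<close> be the event that \<open>X\<^sub>0, \<dots>, X\<^sub>n\<^sub>-\<^sub>1\<close> are
  all below \<open>b\<close>. Then \<open>X\<^sub>n - b = S\<^sub>n - R\<close>, and \<open>R > 0\<close> on \<open>F\<close> because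
  \<open>b \<ge> 0\<close> and \<open>0 < lam < 1\<close>. Hence \<open>\<tau> = n\<close> means that \<open>F\<close> occurs and the \<open>n\<close>-th phase
  chain \<open>J\<^sub>n\<close> is not yet absorbed at time \<open>R\<close>. In that case the embedded process \<open>Y\<close>, which
  increases with slope one between its jumps, first reaches \<open>b\<close> exactly when \<open>J\<^sub>n\<close> has run for
  time \<open>R\<close>, so \<open>G\<^sub>i\<close> says that \<open>J\<^sub>n(R) = i\<close> (\<open>tau_hat_embed_Y\<close>). An overshoot of at most \<open>y\<close>
  says moreover that \<open>J\<^sub>n\<close> is absorbed by time \<open>R + y\<close>.

  The pair \<open>(F, R)\<close> depends only on \<open>J\<^sub>1, \<dots>, J\<^sub>n\<^sub>-\<^sub>1\<close> and \<open>T\<^sub>1, \<dots>, T\<^sub>n\<close> and is therefore independent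
  of \<open>J\<^sub>n\<close> (\<open>indep_past_sigma\<close>). The theorem thus reduces to the Markov property of \<open>J\<^sub>n\<close> at the
  independent random time \<open>R\<close> (\<open>chain_at_independent_time\<close>): on \<open>F\<close> and given \<open>J\<^sub>n(R) = i\<close>, the chain is absorbed
  within a further time \<open>y\<close> with probability \<open>exp(y Q_hat)\<^sub>i\<^sub>\<Delta> = H\<^sub>e\<^sub>i(y)\<close>.

  Two almost sure statements make this rigorous. Absorption happens at a finite positive time
  (\<open>AE_absorption\<close>); finiteness is where transience enters, through the matrix statement
  \<open>transient_absorption_tendsto\<close>. And absorption does not happen exactly at \<open>R\<close>
  (\<open>absorption_not_at_independent_time\<close>): if it did, \<open>X\<^sub>n\<close> would equal \<open>b\<close>, and \<open>Y\<close> would jump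
  just before reaching the level.
\<close>

section \<open>The matrix exponential\<close>

abbreviation mat_pow :: "real ^ 's ^ 's \<Rightarrow> nat \<Rightarrow> real ^ 's::finite ^ 's" where
  "mat_pow A k \<equiv> (((**) A) ^^ k) (mat 1)"

lemma matrix_mult_nth: "(A ** B) $ i $ j = (\<Sum>l\<in>UNIV. A $ i $ l * B $ l $ j)"
  by (simp add: matrix_matrix_mult_def)

lemma matrix_mult_scaleR_left: "(c *\<^sub>R A) ** B = c *\<^sub>R (A ** B)" for A :: "real ^ _ ^ _"
  by (simp add: vec_eq_iff matrix_mult_nth sum_distrib_left mult_ac)

lemma matrix_mult_scaleR_right: "A ** (c *\<^sub>R B) = c *\<^sub>R (A ** B)" for A :: "real ^ _ ^ _"
  by (simp add: vec_eq_iff matrix_mult_nth sum_distrib_left mult_ac)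

lemma matrix_mult_add_left: "(A + B) ** C = A ** C + B ** C" for A :: "real ^ _ ^ _"
  by (simp add: vec_eq_iff matrix_mult_nth distrib_right sum.distrib)

lemma matrix_mult_sum_right: "A ** (\<Sum>k\<in>K. B k) = (\<Sum>k\<in>K. A ** B k)" for A :: "real ^ 's ^ 's::finite"
  by (induction K rule: infinite_finite_induct) (simp_all add: matrix_add_ldistrib vec_eq_iff matrix_mult_nth)

text \<open>
  Convergence is treated entry by entry: the entries of the \<open>k\<close>-th power are at most \<open>C^k\<close>, where
  \<open>C\<close> is the sum of the absolute values of all entries, so each entry of the exponential is an
  absolutely convergent real series.
\<close>
lemma mat_pow_abs_le:
  "\<bar>mat_pow A k $ i $ j\<bar> \<le> (\<Sum>i\<in>UNIV. \<Sum>j\<in>UNIV. \<bar>A $ i $ j\<bar>) ^ k"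
proof (induction k arbitrary: i)
  case 0
  show ?case by (simp add: mat_def)
next
  case (Suc k)
  let ?C = "\<Sum>i\<in>UNIV. \<Sum>j\<in>UNIV. \<bar>A $ i $ j\<bar>"
  have C: "0 \<le> ?C" by (intro sum_nonneg) auto
  have "\<bar>mat_pow A (Suc k) $ i $ j\<bar> \<le> (\<Sum>l\<in>UNIV. \<bar>A $ i $ l\<bar> * \<bar>mat_pow A k $ l $ j\<bar>)"
    by (simp add: matrix_mult_nth flip: abs_mult)
  also have "\<dots> \<le> (\<Sum>l\<in>UNIV. \<bar>A $ i $ l\<bar> * ?C ^ k)"
    by (intro sum_mono mult_left_mono Suc.IH) auto
  also have "\<dots> = (\<Sum>l\<in>UNIV. \<bar>A $ i $ l\<bar>) * ?C ^ k"
    by (simp add: sum_distrib_right)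
  also have "\<dots> \<le> ?C * ?C ^ k"
    using C by (intro mult_right_mono member_le_sum[of i UNIV "\<lambda>i. \<Sum>j\<in>UNIV. \<bar>A $ i $ j\<bar>"] sum_nonneg) auto
  finally show ?case by simp
qed

lemma mat_exp_terms_abs_le:
  "\<bar>mat_pow A k $ i $ j / fact k\<bar> \<le> (\<Sum>i\<in>UNIV. \<Sum>j\<in>UNIV. \<bar>A $ i $ j\<bar>) ^ k /\<^sub>R fact k"
  using mat_pow_abs_le[of k A i j] by (simp add: divide_right_mono field_simps)

lemma summable_norm_mat_exp:
  "summable (\<lambda>k. norm (mat_pow A k $ i $ j / fact k))"
proof (rule summable_comparison_test')
  show "summable (\<lambda>k. (\<Sum>i\<in>UNIV. \<Sum>j\<in>UNIV. \<bar>A $ i $ j\<bar>) ^ k /\<^sub>R fact k)"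
    by (rule summable_exp_generic)
  show "norm (norm (mat_pow A k $ i $ j / fact k)) \<le> (\<Sum>i\<in>UNIV. \<Sum>j\<in>UNIV. \<bar>A $ i $ j\<bar>) ^ k /\<^sub>R fact k"
    if "0 \<le> k" for k
    unfolding real_norm_def abs_idempotent by (rule mat_exp_terms_abs_le)
qed

lemma mat_exp_sums: "(\<lambda>k. mat_pow A k $ i $ j / fact k) sums (mat_exp A $ i $ j)"
proof -
  have s: "(\<lambda>k. mat_pow A k $ i $ j / fact k) sums (\<Sum>k. mat_pow A k $ i $ j / fact k)" for i j
    by (rule summable_sums[OF summable_norm_cancel[OF summable_norm_mat_exp]])
  have "(\<lambda>k. (1 / fact k) *\<^sub>R mat_pow A k) sums (\<chi> i j. \<Sum>k. mat_pow A k $ i $ j / fact k)"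
    unfolding sums_def
    by (intro vec_tendstoI) (simp add: s[unfolded sums_def])
  from sums_unique[OF this] have "mat_exp A $ i $ j = (\<Sum>k. mat_pow A k $ i $ j / fact k)"
    unfolding mat_exp_def by (metis (lifting) vec_lambda_beta)
  with s show ?thesis by simp
qed

lemma mat_exp_nth: "mat_exp A $ i $ j = (\<Sum>k. mat_pow A k $ i $ j / fact k)"
  using mat_exp_sums by (rule sums_unique)

lemma mat_pow_scaleR: "mat_pow (t *\<^sub>R A) k = t ^ k *\<^sub>R mat_pow A k"
  by (induction k) (simp_all add: matrix_mult_scaleR_left matrix_mult_scaleR_right)

lemma mat_pow_commute:
  assumes "A ** B = B ** A"
  shows "mat_pow A k ** B = B ** mat_pow A k"
  by (induction k) (simp, simp, metis assms matrix_mul_assoc)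

text \<open>
  The binomial theorem for commuting matrices, divided by \<open>n!\<close>. Both sides satisfy
  \<open>(n + 1) c\<^sub>n\<^sub>+\<^sub>1 = (A + B) c\<^sub>n\<close>; for the right-hand side, \<open>n + 1\<close> is
  split as \<open>k + (n + 1 - k)\<close>.
\<close>

lemma mat_exp_term_add:
  fixes A B :: "real ^ 's ^ 's::finite"
  defines "S \<equiv> \<lambda>A n. mat_pow A n /\<^sub>R fact n"
  assumes comm: "A ** B = B ** A"
  shows "S (A + B) n = (\<Sum>k\<le>n. S A k ** S B (n - k))"
proof (induction n)
  case 0
  show ?case by (simp add: S_def)
next
  case (Suc n)
  have step: "A ** S A n = real (Suc n) *\<^sub>R S A (Suc n)" for A :: "real ^ 's ^ 's" and n
    by (simp add: S_def matrix_mult_scaleR_right field_simps del: of_nat_Suc)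
  have S_comm: "B ** S A k = S A k ** B" for k
    by (simp add: S_def matrix_mult_scaleR_right matrix_mult_scaleR_left mat_pow_commute[OF comm])
  have "real (Suc n) *\<^sub>R S (A + B) (Suc n) = (A + B) ** (\<Sum>k\<le>n. S A k ** S B (n - k))"
    by (simp only: step Suc.IH[symmetric])
  also have "\<dots> = (\<Sum>k\<le>n. (A ** S A k) ** S B (n - k)) + (\<Sum>k\<le>n. S A k ** (B ** S B (n - k)))"
    by (simp add: matrix_mult_add_left matrix_mult_sum_right matrix_mul_assoc S_comm sum.distrib)
  also have "\<dots> = (\<Sum>k\<le>n. real (Suc k) *\<^sub>R (S A (Suc k) ** S B (n - k)))
                 + (\<Sum>k\<le>n. real (Suc n - k) *\<^sub>R (S A k ** S B (Suc n - k)))"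
    by (simp add: step matrix_mult_scaleR_left matrix_mult_scaleR_right Suc_diff_le del: of_nat_Suc)
  also have "(\<Sum>k\<le>n. real (Suc k) *\<^sub>R (S A (Suc k) ** S B (n - k)))
             = (\<Sum>k\<le>Suc n. real k *\<^sub>R (S A k ** S B (Suc n - k)))"
    by (subst sum.atMost_Suc_shift) simp
  also have "(\<Sum>k\<le>n. real (Suc n - k) *\<^sub>R (S A k ** S B (Suc n - k)))
             = (\<Sum>k\<le>Suc n. real (Suc n - k) *\<^sub>R (S A k ** S B (Suc n - k)))"
    by simp
  also have "(\<Sum>k\<le>Suc n. real k *\<^sub>R (S A k ** S B (Suc n - k))) + \<dots>
             = (\<Sum>k\<le>Suc n. real (Suc n) *\<^sub>R (S A k ** S B (Suc n - k)))"
    by (simp flip: sum.distrib scaleR_add_left of_nat_add)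
  also have "\<dots> = real (Suc n) *\<^sub>R (\<Sum>k\<le>Suc n. S A k ** S B (Suc n - k))"
    by (simp only: scaleR_right.sum)
  finally show ?case
    by (simp del: sum.cl_ivl_Suc)
qed

text \<open>
  Entry by entry this is a finite sum of Cauchy products of absolutely convergent real series.
\<close>
lemma mat_exp_add_commuting:
  assumes comm: "A ** B = B ** A"
  shows "mat_exp (A + B) = mat_exp A ** mat_exp B"
proof -
  have "mat_exp (A + B) $ i $ j = (mat_exp A ** mat_exp B) $ i $ j" for i j
  proof -
    let ?a = "\<lambda>l k. mat_pow A k $ i $ l / fact k" and ?b = "\<lambda>l k. mat_pow B k $ l $ j / fact k"
    have "(\<lambda>n. \<Sum>l\<in>UNIV. \<Sum>k\<le>n. ?a l k * ?b l (n - k)) sums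
          (\<Sum>l\<in>UNIV. (\<Sum>k. ?a l k) * (\<Sum>k. ?b l k))"
      by (intro sums_sum Cauchy_product_sums summable_norm_mat_exp)
    also have "(\<lambda>n. \<Sum>l\<in>UNIV. \<Sum>k\<le>n. ?a l k * ?b l (n - k)) = (\<lambda>n. mat_pow (A + B) n $ i $ j / fact n)"
    proof
      fix n
      have "mat_pow (A + B) n $ i $ j / fact n = (mat_pow (A + B) n /\<^sub>R fact n) $ i $ j"
        by (simp add: field_simps)
      also have "\<dots> = (\<Sum>k\<le>n. \<Sum>l\<in>UNIV. ?a l k * ?b l (n - k))"
        unfolding mat_exp_term_add[OF comm]
        by (simp add: matrix_mult_nth field_simps)
      finally show "(\<Sum>l\<in>UNIV. \<Sum>k\<le>n. ?a l k * ?b l (n - k)) = mat_pow (A + B) n $ i $ j / fact n"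
        by (subst sum.swap) simp
    qed
    finally show ?thesis
      by (simp add: matrix_mult_nth mat_exp_nth sums_iff)
  qed
  thus ?thesis by (simp add: vec_eq_iff)
qed

lemma mat_exp_add: "mat_exp ((s + t) *\<^sub>R A) = mat_exp (s *\<^sub>R A) ** mat_exp (t *\<^sub>R A)"
  using mat_exp_add_commuting[of "s *\<^sub>R A" "t *\<^sub>R A"]
  by (simp add: scaleR_add_left matrix_mult_scaleR_left matrix_mult_scaleR_right mult.commute)

lemma mat_exp_zero: "mat_exp (0 :: real ^ 's ^ 's::finite) = mat 1"
proof -
  fix A :: "real ^ 's ^ 's"
  have "(\<lambda>k. mat_pow (0 *\<^sub>R A) k $ i $ j / fact k) sums (mat 1 $ i $ j)" for i j
    unfolding mat_pow_scaleR
    using sums_single[of 0 "\<lambda>k. mat 1 $ i $ j :: real"]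
    by (rule sums_cong[THEN iffD1, rotated]) auto
  hence "mat_exp (0 *\<^sub>R A) $ i $ j = mat 1 $ i $ j" for i j
    by (rule sums_unique2[OF mat_exp_sums])
  thus ?thesis by (simp add: vec_eq_iff)
qed

lemma mat_exp_scalar: "mat_exp (c *\<^sub>R mat 1 :: real ^ 's ^ 's::finite) = exp c *\<^sub>R mat 1"
proof -
  have "mat_pow (mat 1 :: real ^ 's ^ 's) k = mat 1" for k
    by (induction k) auto
  hence *: "mat_pow (c *\<^sub>R mat 1 :: real ^ 's ^ 's) k $ i $ j / fact k = (c ^ k /\<^sub>R fact k) * mat 1 $ i $ j" for k i j
    unfolding mat_pow_scaleR by (simp add: field_simps)
  have "mat_exp (c *\<^sub>R mat 1 :: real ^ 's ^ 's) $ i $ j = exp c * mat 1 $ i $ j" for i j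
    using sums_mult2[OF exp_converges[of c], of "mat 1 $ i $ j"] mat_exp_sums[of "c *\<^sub>R mat 1 :: real ^ 's ^ 's" i j]
    unfolding * by (rule sums_unique2[symmetric])
  thus ?thesis by (simp add: vec_eq_iff)
qed

text \<open>
  Adding a large multiple of the identity turns a generator into a matrix with nonnegative
  entries, whose powers and exponential are nonnegative, and changes the exponential only by a
  positive factor.
\<close>

lemma mat_exp_nonneg:
  assumes off_diag: "\<And>i j. i \<noteq> j \<Longrightarrow> 0 \<le> A $ i $ j"
  shows "0 \<le> mat_exp A $ i $ j"
proof -
  define c where "c = (\<Sum>i\<in>UNIV. \<bar>A $ i $ i\<bar>)"
  define B where "B = A + c *\<^sub>R mat 1"
  have c: "\<bar>A $ i $ i\<bar> \<le> c" for i
    unfolding c_def by (rule member_le_sum) auto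
  have B: "0 \<le> B $ i $ j" for i j
    using off_diag[of i j] c[of i] by (auto simp: B_def mat_def)
  have "0 \<le> mat_pow B k $ i $ j" for k i j
    by (induction k arbitrary: i) (auto simp: mat_def matrix_mult_nth intro!: sum_nonneg mult_nonneg_nonneg B)
  hence "0 \<le> mat_exp B $ i $ j"
    unfolding mat_exp_nth
    by (intro suminf_nonneg summable_norm_cancel[OF summable_norm_mat_exp]) auto
  moreover have "A = B + (- c) *\<^sub>R mat 1"
    by (simp add: B_def)
  hence "mat_exp A = exp (- c) *\<^sub>R mat_exp B"
    using mat_exp_add_commuting[of B "(- c) *\<^sub>R mat 1"]
    by (simp add: matrix_mult_scaleR_left matrix_mult_scaleR_right mat_exp_scalar del: scaleR_minus_left)
  ultimately show ?thesis by simp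
qed

lemma mat_exp_row_sum:
  assumes "\<And>i. (\<Sum>j\<in>UNIV. A $ i $ j) = 0"
  shows "(\<Sum>j\<in>UNIV. mat_exp A $ i $ j) = 1"
proof -
  have pow: "(\<Sum>j\<in>UNIV. mat_pow A k $ i $ j) = (if k = 0 then 1 else 0)" for k i
  proof (induction k arbitrary: i)
    case (Suc k)
    have "(\<Sum>j\<in>UNIV. mat_pow A (Suc k) $ i $ j) = (\<Sum>l\<in>UNIV. A $ i $ l * (\<Sum>j\<in>UNIV. mat_pow A k $ l $ j))"
      unfolding sum_distrib_left by (subst sum.swap) (simp add: matrix_mult_nth)
    also have "\<dots> = 0"
      unfolding Suc.IH by (simp add: assms flip: sum_distrib_right)
    finally show ?case by simp
  qed (simp add: mat_def)
  have "(\<lambda>k. \<Sum>j\<in>UNIV. mat_pow A k $ i $ j / fact k) sums (\<Sum>j\<in>UNIV. mat_exp A $ i $ j)"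
    by (intro sums_sum mat_exp_sums)
  moreover have "(\<lambda>k. \<Sum>j\<in>UNIV. mat_pow A k $ i $ j / fact k) = (\<lambda>k. if k = 0 then 1 else 0)"
    unfolding sum_divide_distrib[symmetric] pow by auto
  ultimately show ?thesis
    using sums_single[of 0 "\<lambda>_. 1::real"] by (simp only: sums_unique2)
qed

lemma mat_exp_generator_nonneg:
  assumes "is_generator A" "0 \<le> t"
  shows "0 \<le> mat_exp (t *\<^sub>R A) $ i $ j"
  using assms by (intro mat_exp_nonneg) (simp add: is_generator_def)

lemma mat_exp_generator_row_sum:
  assumes "is_generator A"
  shows "(\<Sum>j\<in>UNIV. mat_exp (t *\<^sub>R A) $ i $ j) = 1"
  using assms by (intro mat_exp_row_sum) (simp add: is_generator_def flip: sum_distrib_left)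

text \<open>
  Without its constant term, the series of an entry is dominated by that of
  \<open>exp (t C) - 1\<close>, where \<open>C\<close> is the sum of the absolute values of all entries of \<open>A\<close>.
\<close>
lemma tendsto_mat_exp_0:
  "((\<lambda>t. mat_exp (t *\<^sub>R A) $ i $ j) \<longlongrightarrow> mat 1 $ i $ j) (at_right 0)"
proof -
  define C where "C = (\<Sum>i\<in>UNIV. \<Sum>j\<in>UNIV. \<bar>A $ i $ j\<bar>)"
  have bound: "\<bar>mat_exp (t *\<^sub>R A) $ i $ j - mat 1 $ i $ j\<bar> \<le> exp (t * C) - 1" if "0 \<le> t" for t
  proof -
    let ?a = "\<lambda>k. mat_pow (t *\<^sub>R A) k $ i $ j / fact k" and ?e = "\<lambda>k. (t * C) ^ k /\<^sub>R fact k"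
    have tC: "(\<Sum>i\<in>UNIV. \<Sum>j\<in>UNIV. \<bar>(t *\<^sub>R A) $ i $ j\<bar>) = t * C"
      using that by (simp add: C_def abs_mult sum_distrib_left)
    have a: "(\<lambda>k. ?a (Suc k)) sums (mat_exp (t *\<^sub>R A) $ i $ j - mat 1 $ i $ j)"
      using mat_exp_sums[of "t *\<^sub>R A" i j] by (subst sums_Suc_iff) simp
    moreover have e: "(\<lambda>k. ?e (Suc k)) sums (exp (t * C) - 1)"
      using exp_converges[of "t * C"] by (subst sums_Suc_iff) simp
    moreover have "\<bar>?a k\<bar> \<le> ?e k" for k
      using mat_exp_terms_abs_le[of k "t *\<^sub>R A" i j] unfolding tC .
    ultimately have "norm (\<Sum>k. ?a (Suc k)) \<le> (\<Sum>k. ?e (Suc k))"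
      by (intro norm_suminf_le[OF _ sums_summable[OF e]]) (simp only: real_norm_def)
    thus ?thesis
      using sums_unique[OF a] sums_unique[OF e] by (simp only: real_norm_def)
  qed
  have lim: "((\<lambda>t. exp (t * C) - 1) \<longlongrightarrow> 0) (at_right 0)"
    by (auto intro!: tendsto_eq_intros)
  have "\<forall>\<^sub>F t in at_right 0. norm (mat_exp (t *\<^sub>R A) $ i $ j - mat 1 $ i $ j) \<le> exp (t * C) - 1"
    by (rule eventually_mono[OF eventually_at_right_less]) (simp only: real_norm_def, rule bound, rule less_imp_le)
  from Lim_null_comparison[OF this lim] show ?thesis
    by (simp only: LIM_zero_iff)
qed

lemma borel_measurable_mat_exp:
  "(\<lambda>t. mat_exp (t *\<^sub>R A) $ i $ j) \<in> borel_measurable borel"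
  unfolding mat_exp_nth mat_pow_scaleR vector_scaleR_component by measurable

section \<open>Absorption of a transient chain\<close>

lemma row_sum_Q_hat: "(\<Sum>j\<in>UNIV. Q_hat Q $ i $ j) = 0"
  by (cases i) (simp_all add: Q_hat_def UNIV_option_conv sum.reindex matrix_vector_mult_def sum_negf)

lemma mat_exp_Q_hat_None: "mat_exp (t *\<^sub>R Q_hat Q) $ None $ j = (if j = None then 1 else 0)"
proof -
  have pow: "mat_pow (Q_hat Q) k $ None $ j = (if k = 0 \<and> j = None then 1 else 0)" for k
    by (cases k) (auto simp: mat_def matrix_mult_nth Q_hat_def)
  have "(\<lambda>k. mat_pow (t *\<^sub>R Q_hat Q) k $ None $ j / fact k) = (\<lambda>k. if k = 0 then (if j = None then 1 else 0) else 0)"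
    unfolding mat_pow_scaleR by (auto simp: pow)
  with mat_exp_sums[of "t *\<^sub>R Q_hat Q" None j] sums_single[of 0 "\<lambda>_. if j = None then 1 else 0::real"]
  show ?thesis
    by (simp only: sums_unique2)
qed

lemma mat_exp_Q_hat_Some: "mat_exp (t *\<^sub>R Q_hat Q) $ Some i $ Some j = mat_exp (t *\<^sub>R Q) $ i $ j"
proof -
  have "mat_pow (Q_hat Q) k $ Some i $ Some j = mat_pow Q k $ i $ j" for k
  proof (induction k arbitrary: i)
    case (Suc k)
    have "mat_pow (Q_hat Q) k $ None $ Some j = 0"
      by (cases k) (auto simp: mat_def matrix_mult_nth Q_hat_def)
    with Suc show ?case
      by (simp add: matrix_mult_nth UNIV_option_conv sum.reindex Q_hat_def)
  qed (simp add: mat_def)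
  thus ?thesis
    unfolding mat_exp_nth mat_pow_scaleR by simp
qed

text \<open>
  The phasetype distribution function started in \<open>i\<close> is the probability of having moved from
  \<open>i\<close> to the absorbing state: the block of \<open>exp (y Q_hat)\<close> on the transient states is
  \<open>exp (y Q)\<close>, and the rows of \<open>exp (y Q_hat)\<close> sum to one.
\<close>
lemma PH_cdf_unit:
  assumes "0 \<le> y"
  shows "PH_cdf Q (axis i 1) y = mat_exp (y *\<^sub>R Q_hat Q) $ Some i $ None"
proof -
  have "(\<Sum>j\<in>UNIV. mat_exp (y *\<^sub>R Q_hat Q) $ Some i $ j) = 1"
    by (rule mat_exp_row_sum) (simp add: row_sum_Q_hat flip: sum_distrib_left)
  hence "mat_exp (y *\<^sub>R Q_hat Q) $ Some i $ None + (\<Sum>j\<in>UNIV. mat_exp (y *\<^sub>R Q) $ i $ j) = 1"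
    by (simp add: UNIV_option_conv sum.reindex mat_exp_Q_hat_Some)
  moreover have "(axis i 1 v* mat_exp (y *\<^sub>R Q)) \<bullet> (\<chi> _. 1) = (\<Sum>j\<in>UNIV. mat_exp (y *\<^sub>R Q) $ i $ j)"
    by (simp add: inner_vec_def vector_matrix_mult_def axis_def mult_delta_left mult_delta_right)
  ultimately show ?thesis
    using assms by (simp add: PH_cdf_def)
qed

text \<open>
  Transience is a statement about returns only, and has to be turned into one about absorption.
  If \<open>i\<close> could not reach the absorbing state, then among the states reachable from \<open>i\<close> choose
  \<open>k\<close> with the fewest reachable states. Every \<open>j\<close> reachable from \<open>k\<close> leads back to \<open>k\<close>,
  so \<open>p\<^sub>j\<^sub>j(s + t) \<ge> p\<^sub>j\<^sub>k(s) p\<^sub>k\<^sub>j(t)\<close> with \<open>p\<^sub>j\<^sub>k(s) > 0\<close> for some \<open>s\<close>, and the expected time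
  spent in \<open>j\<close> from \<open>k\<close> is finite. Summed over all such \<open>j\<close> it is the length of the whole
  time axis, a contradiction.
\<close>
lemma transient_reaches_None:
  assumes gen: "is_generator (Q_hat Q)"
    and transient: "\<And>i. transient_state (Q_hat Q) (Some i)"
  shows "\<exists>s\<ge>0. 0 < mat_exp (s *\<^sub>R Q_hat Q) $ Some i $ None"
proof (rule ccontr)
  assume contra: "\<not> (\<exists>s\<ge>0. 0 < mat_exp (s *\<^sub>R Q_hat Q) $ Some i $ None)"
  define p where "p t i j = mat_exp (t *\<^sub>R Q_hat Q) $ i $ j" for t i j
  have p_nonneg: "0 \<le> p t i j" if "0 \<le> t" for t i j
    unfolding p_def using gen that by (rule mat_exp_generator_nonneg)
  have [measurable]: "(\<lambda>t. p t i j) \<in> borel_measurable borel" for i j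
    unfolding p_def by (rule borel_measurable_mat_exp)
  have p_sum: "(\<Sum>j\<in>UNIV. p t i j) = 1" for t i
    unfolding p_def using gen by (rule mat_exp_generator_row_sum)
  have p_mono: "p s i j * p t j l \<le> p (s + t) i l" if "0 \<le> s" "0 \<le> t" for s t i j l
    unfolding p_def mat_exp_add matrix_mult_nth
    using p_nonneg that by (intro member_le_sum) (auto simp: p_def)
  define reach where "reach i = {j. \<exists>s\<ge>0. 0 < p s i j}" for i
  have refl: "i \<in> reach i" for i
    unfolding reach_def by (auto simp: p_def mat_exp_zero mat_def intro!: exI[of _ 0])
  have trans: "reach j \<subseteq> reach i" if "j \<in> reach i" for i j
  proof
    fix l assume "l \<in> reach j"
    with that obtain s t where st: "0 \<le> s" "0 < p s i j" "0 \<le> t" "0 < p t j l"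
      by (auto simp: reach_def)
    hence "0 < p (s + t) i l"
      using p_mono[of s t i j l] mult_pos_pos[of "p s i j" "p t j l"] by linarith
    with st show "l \<in> reach i"
      by (auto simp: reach_def intro!: exI[of _ "s + t"])
  qed
  obtain k where k: "k \<in> reach (Some i)" "\<And>j. j \<in> reach (Some i) \<Longrightarrow> card (reach k) \<le> card (reach j)"
    using ex_has_least_nat[of "\<lambda>k. k \<in> reach (Some i)" "Some i" "\<lambda>k. card (reach k)"] refl by auto
  have None_notin: "None \<notin> reach k"
    using contra trans[OF k(1)] by (auto simp: reach_def p_def)
  have return: "k \<in> reach j" if "j \<in> reach k" for j
  proof -
    have "j \<in> reach (Some i)"
      using trans[OF k(1)] that by blast
    hence "reach j = reach k"
      by (intro card_seteq trans[OF that] k(2)) simp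
    with refl show ?thesis by blast
  qed
  have finite_time: "(\<integral>\<^sup>+ t \<in> {0..}. ennreal (p t k j) \<partial>lborel) < \<infinity>" if j: "j \<in> reach k" for j
  proof -
    obtain j' where j': "j = Some j'"
      using None_notin j by (cases j) auto
    obtain s where s: "0 \<le> s" "0 < p s j k"
      using return[OF j] by (auto simp: reach_def)
    define g where "g = (\<lambda>u. ennreal (p u j j) * indicator {0..} u)"
    have [measurable]: "g \<in> borel_measurable borel"
      unfolding g_def by measurable
    have "ennreal (p s j k) * (\<integral>\<^sup>+ t \<in> {0..}. ennreal (p t k j) \<partial>lborel)
          = (\<integral>\<^sup>+ t. ennreal (p s j k) * (ennreal (p t k j) * indicator {0..} t) \<partial>lborel)"
      by (rule nn_integral_cmult[symmetric]) measurable
    also have "\<dots> \<le> (\<integral>\<^sup>+ t. g (s + t) \<partial>lborel)"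
      using p_mono[OF s(1)] s p_nonneg
      by (intro nn_integral_mono) (auto simp: g_def indicator_def ennreal_mult[symmetric] intro!: ennreal_leI)
    also have "\<dots> = (\<integral>\<^sup>+ t. g t \<partial>lborel)"
      using nn_integral_real_affine[of g 1 s] by simp
    also have "\<dots> < \<infinity>"
      using transient[of j'] by (simp add: transient_state_def g_def p_def j')
    finally show ?thesis
      using s(2) by (auto simp: ennreal_mult_less_top less_top)
  qed
  have "(\<integral>\<^sup>+ t. indicator {0::real..} t \<partial>lborel)
        = (\<integral>\<^sup>+ t. (\<Sum>j\<in>reach k. ennreal (p t k j) * indicator {0..} t) \<partial>lborel)"
  proof (rule nn_integral_cong)
    fix t :: real
    show "indicator {0..} t = (\<Sum>j\<in>reach k. ennreal (p t k j) * indicator {0..} t)"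
    proof (cases "0 \<le> t")
      case True
      have "(\<Sum>j\<in>reach k. p t k j) = (\<Sum>j\<in>UNIV. p t k j)"
        using p_nonneg[OF True] True by (intro sum.mono_neutral_left) (auto simp: reach_def not_less intro: antisym)
      with True show ?thesis
        by (simp add: sum_ennreal p_nonneg p_sum)
    qed simp
  qed
  also have "\<dots> = (\<Sum>j\<in>reach k. \<integral>\<^sup>+ t \<in> {0..}. ennreal (p t k j) \<partial>lborel)"
    by (intro nn_integral_sum) measurable
  also have "\<dots> < \<infinity>"
    using finite_time by (auto simp: less_top)
  finally have finite: "emeasure lborel {0::real..} < \<infinity>"
    by simp
  then obtain r where r: "emeasure lborel {0::real..} = ennreal r" "0 \<le> r"
    by (cases "emeasure lborel {0::real..}") auto
  obtain m :: nat where m: "r \<le> real m"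
    using real_arch_simple by blast
  have "ennreal (real (Suc m)) = emeasure lborel {0..real (Suc m)}"
    by simp
  also have "\<dots> \<le> ennreal r"
    unfolding r(1)[symmetric] by (intro emeasure_mono) auto
  finally show False
    using r(2) m by (subst (asm) ennreal_le_iff) auto
qed

text \<open>
  By finiteness of the state space there are a time \<open>s\<close> and an \<open>e > 0\<close> such that from every
  state the chain is absorbed within time \<open>s\<close> with probability at least \<open>e\<close>; so it survives
  \<open>k\<close> periods of length \<open>s\<close> with probability at most \<open>(1 - e)^k\<close>.
\<close>
lemma transient_absorption_tendsto:
  assumes gen: "is_generator (Q_hat Q)"
    and transient: "\<And>i. transient_state (Q_hat Q) (Some i)"
  shows "\<exists>s\<ge>0. \<forall>i. (\<lambda>k. mat_exp ((real k * s) *\<^sub>R Q_hat Q) $ Some i $ None) \<longlonglongrightarrow> 1"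
proof -
  define p where "p t i j = mat_exp (t *\<^sub>R Q_hat Q) $ i $ j" for t i j
  have p_nonneg: "0 \<le> p t i j" if "0 \<le> t" for t i j
    unfolding p_def using gen that by (rule mat_exp_generator_nonneg)
  have p_sum: "(\<Sum>j\<in>UNIV. p t i j) = 1" for t i
    unfolding p_def using gen by (rule mat_exp_generator_row_sum)
  have p_add: "p (s + t) i l = (\<Sum>j\<in>UNIV. p s i j * p t j l)" for s t i l
    unfolding p_def mat_exp_add matrix_mult_nth ..
  have p_None: "p t None None = 1" for t
    by (simp add: p_def mat_exp_Q_hat_None)
  have p_mono: "p s i None \<le> p t i None" if "0 \<le> s" "s \<le> t" for s t i
    using p_add[of s "t - s" i None] p_None p_nonneg[of s] p_nonneg[of "t - s"] that
      member_le_sum[of None UNIV "\<lambda>j. p s i j * p (t - s) j None"] by auto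
  have p_le: "p t i None \<le> 1" if "0 \<le> t" for t i
    using p_sum[of t i] member_le_sum[of None UNIV "p t i"] p_nonneg[OF that] by auto
  obtain r where r: "\<And>i. 0 \<le> r i" "\<And>i. 0 < p (r i) (Some i) None"
    using transient_reaches_None[OF assms] unfolding p_def by metis
  define s where "s = (\<Sum>i\<in>UNIV. r i)"
  have r_le: "r i \<le> s" for i
    unfolding s_def using r by (intro member_le_sum) auto
  have s: "0 \<le> s"
    unfolding s_def using r by (intro sum_nonneg) auto
  define e where "e = Min (range (\<lambda>i. p s (Some i) None))"
  have "0 < e"
    unfolding e_def using less_le_trans[OF r(2) p_mono[OF r(1) r_le]] by simp
  have e_le: "e \<le> p s (Some i) None" for i
    unfolding e_def by (intro Min_le) auto
  have "e \<le> 1"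
    using e_le p_le[OF s] order_trans by blast
  have bound: "1 - p (real k * s) (Some i) None \<le> (1 - e) ^ k" for k i
  proof (induction k arbitrary: i)
    case 0
    show ?case using p_nonneg by simp
  next
    case (Suc k)
    have "1 - p (real (Suc k) * s) (Some i) None
          = (\<Sum>j\<in>UNIV. p s (Some i) j * (1 - p (real k * s) j None))"
      using p_add[of s "real k * s" "Some i" None]
      by (simp add: algebra_simps sum_subtractf p_sum)
    also have "\<dots> \<le> (\<Sum>j\<in>UNIV. p s (Some i) j * (if j = None then 0 else (1 - e) ^ k))"
      using Suc.IH p_nonneg[OF s] by (intro sum_mono mult_left_mono) (auto simp: p_None split: option.split)
    also have "\<dots> = (1 - p s (Some i) None) * (1 - e) ^ k"
      using p_sum[of s "Some i"]
      by (simp add: UNIV_option_conv sum.reindex flip: sum_distrib_right)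
    also have "\<dots> \<le> (1 - e) * (1 - e) ^ k"
      using e_le \<open>e \<le> 1\<close> by (intro mult_right_mono) auto
    finally show ?case by simp
  qed
  have "(\<lambda>k. 1 - p (real k * s) (Some i) None) \<longlonglongrightarrow> 0" for i
  proof (rule tendsto_sandwich[OF _ _ tendsto_const])
    show "(\<lambda>k. (1 - e) ^ k) \<longlonglongrightarrow> 0"
      using \<open>0 < e\<close> \<open>e \<le> 1\<close> by (intro LIMSEQ_realpow_zero) auto
  qed (use bound p_le s in auto)
  hence "(\<lambda>k. p (real k * s) (Some i) None) \<longlonglongrightarrow> 1" for i
    using tendsto_diff[OF tendsto_const[of 1]] by fastforce
  thus ?thesis
    using s unfolding p_def by blast
qed

section \<open>Markov chains and their paths\<close>

lemma (in finite_measure) measure_split_finite_range: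
  fixes X :: "'a \<Rightarrow> 's::finite"
  assumes "X \<in> measurable M (count_space UNIV)" "{\<omega> \<in> space M. P \<omega>} \<in> sets M"
  shows "measure M {\<omega> \<in> space M. P \<omega>} = (\<Sum>i\<in>UNIV. measure M {\<omega> \<in> space M. P \<omega> \<and> X \<omega> = i})"
proof -
  note [measurable] = assms
  have "measure M (\<Union>i. {\<omega> \<in> space M. P \<omega> \<and> X \<omega> = i}) = (\<Sum>i\<in>UNIV. measure M {\<omega> \<in> space M. P \<omega> \<and> X \<omega> = i})"
    by (intro finite_measure_finite_Union) (auto simp: disjoint_family_on_def)
  thus ?thesis
    by (rule back_subst[where P = "\<lambda>A. measure M A = _"]) auto
qed

lemma markov_chain_measurable: "markov_chain M A p J \<Longrightarrow> 0 \<le> t \<Longrightarrow> J t \<in> measurable M (count_space UNIV)"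
  by (simp add: markov_chain_def)

lemma markov_chain_right_continuous:
  "markov_chain M A p J \<Longrightarrow> AE \<omega> in M. \<forall>t\<ge>0. \<forall>\<^sub>F u in at_right t. J u \<omega> = J t \<omega>"
  by (simp add: markov_chain_def)

lemma markov_chain_fdd:
  assumes "markov_chain M A p J" "t 0 = 0" "\<And>l. l < k \<Longrightarrow> t l \<le> t (Suc l)"
  shows "measure M {\<omega> \<in> space M. \<forall>l\<le>k. J (t l) \<omega> = s l} =
         p $ s 0 * (\<Prod>l<k. mat_exp ((t (Suc l) - t l) *\<^sub>R A) $ s l $ s (Suc l))"
  using assms unfolding markov_chain_def by blast

lemma markov_chain_initial:
  assumes "markov_chain M A p J"
  shows "measure M {\<omega> \<in> space M. J 0 \<omega> = i} = p $ i"
  using markov_chain_fdd[OF assms, of "\<lambda>_. 0" 0 "\<lambda>_. i"] by simp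

lemma markov_chain_marginal:
  assumes "finite_measure M" "markov_chain M A p J" "0 \<le> t"
  shows "measure M {\<omega> \<in> space M. J t \<omega> = i} = (\<Sum>h\<in>UNIV. p $ h * mat_exp (t *\<^sub>R A) $ h $ i)"
proof -
  note [measurable] = markov_chain_measurable[OF assms(2)]
  have "measure M {\<omega> \<in> space M. J t \<omega> = i \<and> J 0 \<omega> = h} = p $ h * mat_exp (t *\<^sub>R A) $ h $ i" for h
  proof -
    have all: "(\<forall>l\<le>Suc 0. P l) \<longleftrightarrow> P 0 \<and> P (Suc 0)" for P
      by (auto simp: le_Suc_eq)
    from markov_chain_fdd[OF assms(2), of "(\<lambda>_. t)(0 := 0)" "Suc 0" "(\<lambda>_. i)(0 := h)"] assms(3)
    show ?thesis
      unfolding all by (simp add: conj_commute)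
  qed
  with finite_measure.measure_split_finite_range[OF assms(1), of "J 0" "\<lambda>\<omega>. J t \<omega> = i"] assms(3)
  show ?thesis by simp
qed

text \<open>
  The Markov property between two times, from the finite-dimensional distribution at the times
  \<open>0\<close>, \<open>t\<close> and \<open>t + y\<close> summed over the initial state.
\<close>
lemma markov_chain_step:
  assumes "finite_measure M" "markov_chain M A p J" "0 \<le> t" "0 \<le> y"
  shows "measure M {\<omega> \<in> space M. J t \<omega> = i \<and> J (t + y) \<omega> = j}
         = measure M {\<omega> \<in> space M. J t \<omega> = i} * mat_exp (y *\<^sub>R A) $ i $ j"
proof -
  note [measurable] = markov_chain_measurable[OF assms(2)]
  have "measure M {\<omega> \<in> space M. (J t \<omega> = i \<and> J (t + y) \<omega> = j) \<and> J 0 \<omega> = h}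
        = p $ h * mat_exp (t *\<^sub>R A) $ h $ i * mat_exp (y *\<^sub>R A) $ i $ j" for h
  proof -
    have all: "(\<forall>l\<le>Suc (Suc 0). P l) \<longleftrightarrow> P 0 \<and> P (Suc 0) \<and> P (Suc (Suc 0))" for P
      by (auto simp: le_Suc_eq)
    from markov_chain_fdd[OF assms(2), of "(\<lambda>_. t + y)(0 := 0, Suc 0 := t)" "Suc (Suc 0)"
        "(\<lambda>_. j)(0 := h, Suc 0 := i)"] assms(3,4)
    show ?thesis
      unfolding all by (simp add: less_Suc_eq conj_ac mult.assoc)
  qed
  with finite_measure.measure_split_finite_range[OF assms(1), of "J 0" "\<lambda>\<omega>. J t \<omega> = i \<and> J (t + y) \<omega> = j"] assms(3,4)
  show ?thesis
    by (simp add: markov_chain_marginal[OF assms(1,2)] sum_distrib_right)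
qed

text \<open>
  Right continuity transports absorption from rational to arbitrary times, and makes the infimum
  of the absorbed times a minimum. That the absorbing state is never left is demanded between
  rational times only: this is a countable family of conditions, each of which holds almost surely.
\<close>
lemma absorbed_path:
  fixes J :: "real \<Rightarrow> 'w \<Rightarrow> 'm option"
  assumes right_cont: "\<And>t. 0 \<le> t \<Longrightarrow> \<forall>\<^sub>F u in at_right t. J u \<omega> = J t \<omega>"
    and start: "J 0 \<omega> \<noteq> None"
    and absorbing: "\<And>q r. q \<in> \<rat> \<Longrightarrow> r \<in> \<rat> \<Longrightarrow> 0 \<le> q \<Longrightarrow> q \<le> r \<Longrightarrow> J q \<omega> = None \<Longrightarrow> J r \<omega> = None"
    and absorbed: "0 \<le> t\<^sub>0" "J t\<^sub>0 \<omega> = None"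
  defines "a \<equiv> real_of_ereal (absorption_time J \<omega>)"
  shows "0 < a \<and> (\<forall>t\<ge>0. J t \<omega> = None \<longleftrightarrow> a \<le> t)"
proof -
  define N where "N = {t. 0 \<le> t \<and> J t \<omega> = None}"
  have bdd: "bdd_below N" and ne: "N \<noteq> {}" and nonneg: "0 \<le> Inf N"
    using absorbed unfolding N_def by (auto intro: bdd_belowI[of _ 0] cInf_greatest)
  have a: "a = Inf N"
    unfolding a_def absorption_time_def N_def[symmetric] by (simp flip: ereal_Inf'[OF bdd ne])
  have near: "\<exists>q\<in>\<rat>. t < q \<and> q < u \<and> J q \<omega> = J t \<omega>" if "0 \<le> t" "t < u" for t u
  proof -
    from right_cont[OF that(1)] obtain v where v: "t < v" "\<And>w. t < w \<Longrightarrow> w < v \<Longrightarrow> J w \<omega> = J t \<omega>"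
      unfolding eventually_at_right_field by auto
    with Rats_dense_in_real[of t "min u v"] that show ?thesis
      by (metis min_less_iff_conj)
  qed
  have later: "u \<in> N" if t: "t \<in> N" "t \<le> u" for t u
  proof (rule ccontr)
    assume "u \<notin> N"
    with t have "t < u" "0 \<le> t" "0 \<le> u"
      by (cases "t = u"; auto simp: N_def)+
    obtain q where q: "q \<in> \<rat>" "t < q" "q < u" "J q \<omega> = None"
      using near[of t u] t \<open>t < u\<close> by (auto simp: N_def)
    obtain r where r: "r \<in> \<rat>" "u < r" "J r \<omega> = J u \<omega>"
      using near[of u "u + 1"] \<open>0 \<le> u\<close> by auto
    show False
      using absorbing[of q r] q r \<open>0 \<le> t\<close> \<open>0 \<le> u\<close> \<open>u \<notin> N\<close> by (auto simp: N_def)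
  qed
  have "Inf N \<in> N"
  proof (rule ccontr)
    assume notin: "Inf N \<notin> N"
    from right_cont[OF nonneg] obtain v where v: "Inf N < v" "\<And>w. Inf N < w \<Longrightarrow> w < v \<Longrightarrow> J w \<omega> = J (Inf N) \<omega>"
      unfolding eventually_at_right_field by auto
    obtain t where t: "t \<in> N" "t < v"
      using cInf_lessD[OF ne v(1)] by auto
    moreover have "Inf N \<le> t"
      using cInf_lower[OF t(1) bdd] .
    ultimately show False
      using v(2)[of t] notin nonneg by (cases "t = Inf N") (auto simp: N_def)
  qed
  hence iff: "t \<in> N \<longleftrightarrow> Inf N \<le> t" for t
    using cInf_lower[OF _ bdd] later by blast
  have "0 \<notin> N"
    using start by (simp add: N_def)
  hence "0 < a"
    unfolding a iff by (rule not_le_imp_less)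
  moreover have "J t \<omega> = None \<longleftrightarrow> a \<le> t" if "0 \<le> t" for t
    using iff[of t] that unfolding a by (simp add: N_def)
  ultimately show ?thesis by blast
qed

text \<open>
  The chain starts outside the absorbing state, cannot leave that state between two rational
  times, and by transience is in it at some multiple of a fixed time \<open>s\<close>; each of these fails only on
  a null set, and \<open>absorbed_path\<close> applies to the remaining paths.
\<close>
lemma AE_absorption:
  fixes J :: "real \<Rightarrow> 'w \<Rightarrow> ('m::finite) option"
  assumes "prob_space M"
    and gen: "is_generator (Q_hat Q)"
    and transient: "\<And>i. transient_state (Q_hat Q) (Some i)"
    and chain: "markov_chain M (Q_hat Q) (init_ext \<alpha>) J"
  defines "S \<equiv> \<lambda>\<omega>. real_of_ereal (absorption_time J \<omega>)"
  shows "AE \<omega> in M. 0 < S \<omega> \<and> (\<forall>t\<ge>0. J t \<omega> = None \<longleftrightarrow> S \<omega> \<le> t)"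
proof -
  interpret prob_space M by fact
  note [measurable] = markov_chain_measurable[OF chain]
  have start: "AE \<omega> in M. J 0 \<omega> \<noteq> None"
    using markov_chain_initial[OF chain, of None]
    by (subst AE_iff_measurable[OF _ refl]) (auto simp: emeasure_eq_measure init_ext_def)
  have "AE \<omega> in M. \<forall>q\<in>{q\<in>\<rat>. 0 \<le> q}. \<forall>r\<in>{r\<in>\<rat>. q \<le> r}. J q \<omega> = None \<longrightarrow> J r \<omega> = None"
  proof (intro AE_ball_countable[THEN iffD2] ballI)
    fix q r :: real assume qr: "q \<in> {q\<in>\<rat>. 0 \<le> q}" "r \<in> {r\<in>\<rat>. q \<le> r}"
    have "AE \<omega> in M. \<forall>i. \<not> (J q \<omega> = None \<and> J r \<omega> = Some i)"
    proof (subst AE_all_countable, intro allI)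
      fix i
      have "measure M {\<omega> \<in> space M. J q \<omega> = None \<and> J r \<omega> = Some i} = 0"
        using markov_chain_step[OF finite_measure_axioms chain, of q "r - q" None "Some i"] qr
        by (simp add: mat_exp_Q_hat_None)
      thus "AE \<omega> in M. \<not> (J q \<omega> = None \<and> J r \<omega> = Some i)"
        using qr by (subst AE_iff_measurable[OF _ refl]) (auto simp: emeasure_eq_measure)
    qed
    thus "AE \<omega> in M. J q \<omega> = None \<longrightarrow> J r \<omega> = None"
      by eventually_elim (metis option.exhaust)
  qed (auto intro: countable_subset[OF _ countable_rat])
  moreover have "AE \<omega> in M. \<exists>t\<ge>0. J t \<omega> = None"
  proof -
    obtain s where s: "0 \<le> s" "\<And>i. (\<lambda>k. mat_exp ((real k * s) *\<^sub>R Q_hat Q) $ Some i $ None) \<longlonglongrightarrow> 1"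
      using transient_absorption_tendsto[OF gen transient] by blast
    define N where "N = {\<omega> \<in> space M. \<forall>k::nat. J (real k * s) \<omega> \<noteq> None}"
    have [simp]: "0 \<le> real k * s" for k
      using s(1) by simp
    note [measurable] = markov_chain_measurable[OF chain \<open>0 \<le> real _ * s\<close>]
    have [measurable]: "N \<in> sets M"
      unfolding N_def by measurable
    have sum1: "(\<Sum>h\<in>UNIV. init_ext \<alpha> $ h) = 1"
      using measure_split_finite_range[of "J 0" "\<lambda>_. True"]
      by (simp add: markov_chain_initial[OF chain] prob_space)
    have lim: "(\<lambda>k. mat_exp ((real k * s) *\<^sub>R Q_hat Q) $ h $ None) \<longlonglongrightarrow> 1" for h
      using s(2) by (cases h) (simp_all add: mat_exp_Q_hat_None)
    have "(\<lambda>k. 1 - prob {\<omega> \<in> space M. J (real k * s) \<omega> = None}) \<longlonglongrightarrow> 1 - (\<Sum>h\<in>UNIV. init_ext \<alpha> $ h * 1)"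
      using s(1) by (simp only: markov_chain_marginal[OF finite_measure_axioms chain] mult_nonneg_nonneg of_nat_0_le_iff)
        (intro tendsto_intros lim)
    moreover have "prob N \<le> 1 - prob {\<omega> \<in> space M. J (real k * s) \<omega> = None}" for k
      by (subst prob_compl[symmetric], measurable, rule finite_measure_mono) (auto simp: N_def simp del: not_None_eq)
    ultimately have "prob N \<le> 0"
      by (intro LIMSEQ_le_const) (auto simp: sum1)
    hence "AE \<omega> in M. \<omega> \<notin> N"
      by (subst AE_iff_measurable[of N]) (auto simp: emeasure_eq_measure N_def measure_le_0_iff)
    with AE_space show ?thesis
    proof eventually_elim
      case (elim \<omega>)
      then obtain k :: nat where "J (real k * s) \<omega> = None"
        by (auto simp: N_def)
      thus ?case
        by (intro exI[of _ "real k * s"]) simp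
    qed
  qed
  ultimately show ?thesis
    using start markov_chain_right_continuous[OF chain] unfolding S_def
  proof eventually_elim
    case (elim \<omega>)
    then obtain t where t: "0 \<le> t" "J t \<omega> = None" by blast
    show ?case
      by (rule absorbed_path[where J = J and \<omega> = \<omega>, OF _ _ _ t]) (use elim in auto)
  qed
qed

section \<open>The chain at an independent random time\<close>

lemma cprob_cong_AE:
  assumes "B \<in> sets (completion M)" "A \<subseteq> space M" "AE \<omega> in M. \<omega> \<in> A \<longleftrightarrow> \<omega> \<in> B"
  shows "cprob M A = cprob M B"
proof -
  have iff: "AE \<omega> in completion M. \<omega> \<in> B \<longleftrightarrow> \<omega> \<in> A"
    using AE_completion[OF assms(3)] by eventually_elim blast
  have "A \<in> sets (completion M)"
    by (rule completion.in_sets_AE[OF iff assms(1)]) (simp add: assms(2))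
  thus ?thesis
    using iff assms(1) by (intro measure_eq_AE) auto
qed

text \<open>
  Dominated convergence for indicators. The limit set need only be measurable up to a null set,
  as is the case for events that involve the chain at a random time.
\<close>
lemma (in prob_space) tendsto_cprob:
  assumes A: "\<And>n. A n \<in> events" and B: "B \<subseteq> space M"
    and conv: "AE \<omega> in M. \<forall>\<^sub>F n in sequentially. \<omega> \<in> A n \<longleftrightarrow> \<omega> \<in> B"
  shows "B \<in> sets (completion M)" and "(\<lambda>n. prob (A n)) \<longlonglongrightarrow> cprob M B"
proof -
  note [measurable] = A
  define L where "L = {\<omega> \<in> space M. \<forall>\<^sub>F n in sequentially. \<omega> \<in> A n}"
  have L [measurable]: "L \<in> events"
    unfolding L_def eventually_sequentially by measurable
  have L_iff: "AE \<omega> in M. \<omega> \<in> L \<longleftrightarrow> \<omega> \<in> B"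
    using conv
  proof eventually_elim
    case (elim \<omega>)
    have "(\<forall>\<^sub>F n in sequentially. \<omega> \<in> A n) \<longleftrightarrow> (\<forall>\<^sub>F n in sequentially. \<omega> \<in> B)"
      using elim by (rule eventually_subst)
    thus ?case using B by (auto simp: L_def)
  qed
  hence L_iff': "AE \<omega> in completion M. \<omega> \<in> L \<longleftrightarrow> \<omega> \<in> B"
    by (rule AE_completion)
  show B': "B \<in> sets (completion M)"
    using completion.in_sets_AE[OF L_iff'] L B by auto
  have "(\<lambda>n. \<integral>\<omega>. indicator (A n) \<omega> \<partial>M) \<longlonglongrightarrow> (\<integral>\<omega>. indicator L \<omega> \<partial>M :: real)"
  proof (rule integral_dominated_convergence[where w = "\<lambda>_. 1"])
    show "AE \<omega> in M. (\<lambda>n. indicator (A n) \<omega> :: real) \<longlonglongrightarrow> indicator L \<omega>"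
      using conv L_iff
    proof eventually_elim
      case (elim \<omega>)
      from elim(1) show ?case
        by (intro tendsto_eventually, elim eventually_mono) (use elim(2) in \<open>auto simp: indicator_def\<close>)
    qed
  qed (auto simp: indicator_def)
  moreover have "cprob M B = cprob M L"
    using L_iff' B' L by (intro measure_eq_AE) auto
  ultimately show "(\<lambda>n. prob (A n)) \<longlonglongrightarrow> cprob M B"
    by simp
qed

text \<open>
  The first point of the grid of mesh \<open>1/(m + 1)\<close> that lies strictly to the right of \<open>r\<close> is
  \<open>(\<lfloor>(m + 1) r\<rfloor> + 1)/(m + 1)\<close>. Approach from the right suits the
  one-sided continuity of the paths.
\<close>
lemma filterlim_floor_grid:
  "filterlim (\<lambda>m. (of_int \<lfloor>real (Suc m) * r\<rfloor> + 1) / real (Suc m) + y) (at_right (r + y)) sequentially"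
proof (rule tendsto_imp_filterlim_at_right)
  have upper: "(of_int \<lfloor>real (Suc m) * r\<rfloor> + 1) / real (Suc m) \<le> r + 1 / real (Suc m)"
    and lower: "r < (of_int \<lfloor>real (Suc m) * r\<rfloor> + 1) / real (Suc m)" for m
    using floor_correct[of "real (Suc m) * r"]
    by (auto simp: field_simps simp del: of_nat_Suc)
  have "(\<lambda>m. r + 1 / real (Suc m) + y) \<longlonglongrightarrow> r + 0 + y"
    by (intro tendsto_add tendsto_const LIMSEQ_Suc[OF lim_1_over_n])
  hence lim: "(\<lambda>m. r + 1 / real (Suc m) + y) \<longlonglongrightarrow> r + y"
    by (simp only: add_0_right)
  show "(\<lambda>m. (of_int \<lfloor>real (Suc m) * r\<rfloor> + 1) / real (Suc m) + y) \<longlonglongrightarrow> r + y"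
    by (rule tendsto_sandwich[OF _ _ tendsto_const lim]; intro always_eventually allI add_right_mono upper less_imp_le[OF lower])
  show "\<forall>\<^sub>F m in sequentially. r + y < (of_int \<lfloor>real (Suc m) * r\<rfloor> + 1) / real (Suc m) + y"
    by (intro always_eventually allI add_strict_right_mono lower)
qed

abbreviation chain_events :: "'w measure \<Rightarrow> (real \<Rightarrow> 'w \<Rightarrow> 's) \<Rightarrow> 'w set set" where
  "chain_events M J \<equiv> sigma_sets (space M) {J t -` {s} \<inter> space M | t s. 0 \<le> t}"

lemma chain_events_pair:
  fixes J :: "real \<Rightarrow> 'w \<Rightarrow> 's::finite"
  assumes "0 \<le> t" "0 \<le> u"
  shows "{\<omega> \<in> space M. P (J t \<omega>) (J u \<omega>)} \<in> chain_events M J"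
proof -
  let ?N = "sigma (space M) {J t -` {s} \<inter> space M | t s. 0 \<le> t}"
  have sets: "sets ?N = chain_events M J"
    by (subst sets_measure_of) auto
  have space: "space ?N = space M"
    by (subst space_measure_of) auto
  have "J t \<in> measurable ?N (count_space UNIV)" if "0 \<le> t" for t
  proof (subst measurable_count_space_eq2, simp, intro conjI ballI)
    fix s
    have "J t -` {s} \<inter> space M \<in> chain_events M J"
      using that by blast
    thus "J t -` {s} \<inter> space ?N \<in> sets ?N"
      unfolding sets space .
  qed simp
  note [measurable] = this[OF assms(1)] this[OF assms(2)]
  have "{\<omega> \<in> space ?N. P (J t \<omega>) (J u \<omega>)} \<in> sets ?N"
    by measurable
  thus ?thesis
    unfolding sets space .
qed

text \<open>
  The Markov property at an independent random time \<open>R\<close>. Joint measurability of the chain in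
  time and chance is avoided: \<open>R\<close> is replaced by the next point of a grid to its right. On each
  cell of the grid the time is constant, so independence and the Markov property at that fixed
  time give the identity. As the mesh tends to zero, right
  continuity of the paths identifies the limits of both sides.
\<close>
lemma (in prob_space) chain_at_independent_time:
  fixes J :: "real \<Rightarrow> 'a \<Rightarrow> 's::finite"
  assumes chain: "markov_chain M A p J"
    and N: "space N = space M" and indep: "indep_set (sets N) (chain_events M J)"
    and R: "R \<in> borel_measurable N" and F: "F \<in> sets N" and R_nonneg: "\<And>\<omega>. \<omega> \<in> F \<Longrightarrow> 0 \<le> R \<omega>"
    and y: "0 \<le> y"
  shows "{\<omega> \<in> F. P (J (R \<omega>) \<omega>) (J (R \<omega> + y) \<omega>)} \<in> sets (completion M)"
    and "cprob M {\<omega> \<in> F. J (R \<omega>) \<omega> = i \<and> J (R \<omega> + y) \<omega> = j}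
         = cprob M {\<omega> \<in> F. J (R \<omega>) \<omega> = i} * mat_exp (y *\<^sub>R A) $ i $ j"
proof -
  note [measurable] = R F markov_chain_measurable[OF chain]
  have indepD: "B \<in> events" "prob (B \<inter> C) = prob B * prob C"
    if "B \<in> sets N" "C \<in> chain_events M J" for B C
    using indep_setD[OF indep that] indep_setD_ev1[OF indep] that by auto
  have F_space: "F \<subseteq> space M"
    using sets.sets_into_space[OF F] by (simp add: N)
  define grid where "grid m k = (real k + 1) / real (Suc m)" for m k :: nat
  define R' where "R' m \<omega> = (of_int \<lfloor>real (Suc m) * R \<omega>\<rfloor> + 1) / real (Suc m)" for m \<omega>
  define cell where "cell m k = {\<omega> \<in> F. \<lfloor>real (Suc m) * R \<omega>\<rfloor> = int k}" for m k
  define C where "C P t = {\<omega> \<in> space M. P (J t \<omega>) (J (t + y) \<omega>)}" for P t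
  define E where "E P m = {\<omega> \<in> F. P (J (R' m \<omega>) \<omega>) (J (R' m \<omega> + y) \<omega>)}" for P m
  have grid: "0 \<le> grid m k" for m k
    by (simp add: grid_def)
  have cell_N: "cell m k \<in> sets N" for m k
  proof -
    have "{\<omega> \<in> space N. \<omega> \<in> F \<and> \<lfloor>real (Suc m) * R \<omega>\<rfloor> = int k} \<in> sets N"
      by measurable
    moreover have "{\<omega> \<in> space N. \<omega> \<in> F \<and> \<lfloor>real (Suc m) * R \<omega>\<rfloor> = int k} = cell m k"
      using F_space by (auto simp: cell_def N)
    ultimately show ?thesis by (simp only:)
  qed
  have C: "C P t \<in> chain_events M J" if "0 \<le> t" for P t
    unfolding C_def using that y by (intro chain_events_pair) auto
  have C_ev: "C P t \<in> events" if "0 \<le> t" for P t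
    using C[OF that] indep_setD_ev2[OF indep] by auto
  have E_eq: "E P m = (\<Union>k. cell m k \<inter> C P (grid m k))" for P m
  proof (intro set_eqI iffI)
    fix \<omega> assume \<omega>: "\<omega> \<in> E P m"
    hence "0 \<le> \<lfloor>real (Suc m) * R \<omega>\<rfloor>"
      using R_nonneg by (auto simp: E_def)
    then obtain k where "\<lfloor>real (Suc m) * R \<omega>\<rfloor> = int k"
      using nonneg_int_cases by blast
    thus "\<omega> \<in> (\<Union>k. cell m k \<inter> C P (grid m k))"
      using \<omega> F_space by (auto simp: E_def cell_def C_def grid_def R'_def intro!: exI[of _ k])
  next
    fix \<omega> assume "\<omega> \<in> (\<Union>k. cell m k \<inter> C P (grid m k))"
    thus "\<omega> \<in> E P m"
      by (auto simp: E_def cell_def C_def grid_def R'_def)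
  qed
  have E_ev: "E P m \<in> events" for P m
    unfolding E_eq using indepD(1)[OF cell_N C[OF grid]] C_ev[OF grid] by blast
  have E_sums: "(\<lambda>k. prob (cell m k \<inter> C P (grid m k))) sums prob (E P m)" for P m
    unfolding E_eq using indepD(1)[OF cell_N C[OF grid]] C_ev[OF grid]
    by (intro finite_measure_UNION) (auto simp: disjoint_family_on_def cell_def)
  have conv: "AE \<omega> in M. \<forall>\<^sub>F m in sequentially. \<omega> \<in> E P m \<longleftrightarrow> \<omega> \<in> {\<omega> \<in> F. P (J (R \<omega>) \<omega>) (J (R \<omega> + y) \<omega>)}" for P
    using markov_chain_right_continuous[OF chain]
  proof eventually_elim
    case (elim \<omega>)
    show ?case
    proof (cases "\<omega> \<in> F")
      case True
      have "\<forall>\<^sub>F m in sequentially. J (R' m \<omega> + z) \<omega> = J (R \<omega> + z) \<omega>" if "0 \<le> z" for z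
        unfolding R'_def
        by (rule eventually_compose_filterlim[OF _ filterlim_floor_grid]) (use elim R_nonneg[OF True] that in auto)
      from this[of 0] this[OF y] show ?thesis
        using y by (simp, elim eventually_elim2) (auto simp: E_def)
    qed (simp add: E_def)
  qed
  have sub: "{\<omega> \<in> F. P (J (R \<omega>) \<omega>) (J (R \<omega> + y) \<omega>)} \<subseteq> space M" for P
    using F_space by auto
  show "{\<omega> \<in> F. P (J (R \<omega>) \<omega>) (J (R \<omega> + y) \<omega>)} \<in> sets (completion M)"
    by (rule tendsto_cprob(1)[OF E_ev sub conv])
  note lim = tendsto_cprob(2)[OF E_ev sub conv]
  let ?P = "\<lambda>a b. a = i \<and> b = j" and ?P' = "\<lambda>a b. a = i"
  have "prob (cell m k \<inter> C ?P (grid m k)) = prob (cell m k \<inter> C ?P' (grid m k)) * mat_exp (y *\<^sub>R A) $ i $ j" for m k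
    using markov_chain_step[OF finite_measure_axioms chain grid y, of m k i j]
    by (simp add: indepD(2)[OF cell_N C[OF grid]]) (simp add: C_def)
  hence "prob (E ?P m) = prob (E ?P' m) * mat_exp (y *\<^sub>R A) $ i $ j" for m
    using E_sums[of m ?P] sums_mult2[OF E_sums[of m ?P'], of "mat_exp (y *\<^sub>R A) $ i $ j"]
    by (simp add: sums_unique2)
  with lim[of ?P] tendsto_mult_right[OF lim[of ?P'], of "mat_exp (y *\<^sub>R A) $ i $ j"]
  show "cprob M {\<omega> \<in> F. J (R \<omega>) \<omega> = i \<and> J (R \<omega> + y) \<omega> = j}
         = cprob M {\<omega> \<in> F. J (R \<omega>) \<omega> = i} * mat_exp (y *\<^sub>R A) $ i $ j"
    by (simp add: LIMSEQ_unique)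
qed

text \<open>
  Absorption exactly at time \<open>R\<close> requires, for every small \<open>h > 0\<close>, that the chain is alive at
  the time \<open>R - h\<close> and absorbed a time \<open>h\<close> later. By the Markov property at the
  independent time \<open>R - h\<close>, this has probability at most the sum of the absolute values
  of the entries of \<open>exp (h A)\<close> from living states to the absorbing one, which tends to zero with \<open>h\<close>.
\<close>
lemma (in prob_space) absorption_not_at_independent_time:
  fixes J :: "real \<Rightarrow> 'a \<Rightarrow> ('m::finite) option"
  assumes chain: "markov_chain M A p J"
    and N: "space N = space M" and indep: "indep_set (sets N) (chain_events M J)"
    and R: "R \<in> borel_measurable N"
    and S: "AE \<omega> in M. \<forall>t\<ge>0. J t \<omega> = None \<longleftrightarrow> S \<omega> \<le> t"
  shows "AE \<omega> in M. 0 < R \<omega> \<longrightarrow> S \<omega> \<noteq> R \<omega>"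
proof -
  have away: "AE \<omega> in M. d < R \<omega> \<longrightarrow> S \<omega> \<noteq> R \<omega>" if d: "0 < d" for d
  proof -
    interpret c: prob_space "completion M"
      by (rule prob_space_completion) 
    define F where "F = {\<omega> \<in> space M. d < R \<omega>}"
    define h where "h m = d / real (Suc m)" for m
    define B where "B m i = {\<omega> \<in> F. J (R \<omega> - h m) \<omega> = Some i \<and> J (R \<omega> - h m + h m) \<omega> = None}" for m i
    have h: "0 < h m" "h m \<le> d" for m
      using d by (auto simp: h_def field_simps)
    have F_N: "F \<in> sets N"
      using R unfolding F_def N[symmetric] by measurable
    have R_h: "(\<lambda>\<omega>. R \<omega> - h m) \<in> borel_measurable N" for m
      using R by measurable
    have nonneg: "0 \<le> R \<omega> - h m" if "\<omega> \<in> F" for m \<omega>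
      using that h(2)[of m] by (simp add: F_def)
    note at_time = chain_at_independent_time[OF chain N indep R_h F_N nonneg less_imp_le[OF h(1)]]
    have B_sets: "B m i \<in> sets (completion M)" for m i
      unfolding B_def by (rule at_time(1)[where P = "\<lambda>a b. a = Some i \<and> b = None"])
    have null: "(\<lambda>m. \<Sum>i\<in>UNIV. \<bar>mat_exp (h m *\<^sub>R A) $ Some i $ None\<bar>) \<longlonglongrightarrow> 0"
    proof -
      have "h \<longlonglongrightarrow> 0"
        unfolding h_def by (intro LIMSEQ_Suc lim_const_over_n)
      hence "filterlim h (at_right 0) sequentially"
        using h by (intro tendsto_imp_filterlim_at_right) auto
      hence "(\<lambda>m. mat_exp (h m *\<^sub>R A) $ Some i $ None) \<longlonglongrightarrow> mat 1 $ Some i $ None" for i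
        by (rule filterlim_compose[OF tendsto_mat_exp_0])
      from tendsto_sum[OF tendsto_rabs[OF this]] show ?thesis
        by (simp add: mat_def)
    qed
    have bound: "c.prob (\<Inter>m. \<Union>i. B m i) \<le> (\<Sum>i\<in>UNIV. \<bar>mat_exp (h m *\<^sub>R A) $ Some i $ None\<bar>)" for m
    proof -
      have "c.prob (\<Inter>m. \<Union>i. B m i) \<le> c.prob (\<Union>i. B m i)"
        using B_sets by (intro c.finite_measure_mono) auto
      also have "\<dots> \<le> (\<Sum>i\<in>UNIV. c.prob (B m i))"
        using B_sets by (intro c.finite_measure_subadditive_finite) auto
      also have "\<dots> \<le> (\<Sum>i\<in>UNIV. \<bar>mat_exp (h m *\<^sub>R A) $ Some i $ None\<bar>)"
      proof (intro sum_mono)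
        fix i
        have "c.prob (B m i) = cprob M {\<omega> \<in> F. J (R \<omega> - h m) \<omega> = Some i} * mat_exp (h m *\<^sub>R A) $ Some i $ None"
          unfolding B_def by (rule at_time(2))
        also have "\<dots> \<le> 1 * \<bar>mat_exp (h m *\<^sub>R A) $ Some i $ None\<bar>"
          using c.prob_le_1 by (intro order_trans[OF mult_left_mono mult_right_mono]) auto
        finally show "c.prob (B m i) \<le> \<bar>mat_exp (h m *\<^sub>R A) $ Some i $ None\<bar>"
          by simp
      qed
      finally show ?thesis .
    qed
    have "c.prob (\<Inter>m. \<Union>i. B m i) \<le> 0"
      using bound by (intro LIMSEQ_le_const[OF null]) auto
    hence "AE \<omega> in completion M. \<omega> \<notin> (\<Inter>m. \<Union>i. B m i)"
      using B_sets by (subst c.prob_eq_0[symmetric]) (auto intro: antisym simp: measure_le_0_iff)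
    hence "AE \<omega> in M. \<omega> \<notin> (\<Inter>m. \<Union>i. B m i)"
      by (simp add: AE_completion_iff)
    with S AE_space show ?thesis
    proof eventually_elim
      case (elim \<omega>)
      show ?case
      proof (intro impI notI)
        assume *: "d < R \<omega>" "S \<omega> = R \<omega>"
        have "\<exists>i. \<omega> \<in> B m i" for m
        proof -
          have "J (R \<omega> - h m) \<omega> \<noteq> None" "J (R \<omega>) \<omega> = None"
            using elim(1) * h[of m] d by auto
          thus ?thesis
            using * elim(2) by (auto simp: B_def F_def)
        qed
        with elim(3) show False by blast
      qed
    qed
  qed
  have "AE \<omega> in M. \<forall>m. 1 / real (Suc m) < R \<omega> \<longrightarrow> S \<omega> \<noteq> R \<omega>"
    by (subst AE_all_countable) (auto intro: away)
  thus ?thesis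
    by eventually_elim (metis nat_approx_posE)
qed

section \<open>The embedded process before the first passage\<close>

lemma hitting_time_eq_enat_iff:
  "hitting_time b X \<omega> = enat n \<longleftrightarrow> (\<forall>k<n. X k \<omega> < b) \<and> b \<le> X n \<omega>"
proof (cases "\<exists>k. b \<le> X k \<omega>")
  case True
  define l where "l = (LEAST k. b \<le> X k \<omega>)"
  have l: "b \<le> X l \<omega>" "\<And>k. b \<le> X k \<omega> \<Longrightarrow> l \<le> k"
    using True unfolding l_def by (auto intro: LeastI_ex Least_le)
  hence "hitting_time b X \<omega> = enat l"
    unfolding hitting_time_def by (intro antisym Inf_lower Inf_greatest) auto
  with l show ?thesis
    by (auto simp: not_le[symmetric] intro: antisym)
next
  case False
  hence "hitting_time b X \<omega> = \<infinity>"
    by (simp add: hitting_time_def Inf_enat_def)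
  with False show ?thesis by auto
qed

text \<open>
  The maximum in the definition of the index is meaningful as long as \<open>t\<close> lies before some
  renewal epoch: by positivity of the \<open>S k\<close>, only finitely many epochs precede it.
\<close>
lemma embed_index_eq:
  assumes S_pos: "\<And>k. 1 \<le> k \<Longrightarrow> 0 < S k \<omega>"
    and "(\<Sum>j=1..k. S j \<omega>) \<le> t" "t < (\<Sum>j=1..Suc k. S j \<omega>)"
  shows "embed_index S t \<omega> = k"
proof -
  have mono: "(\<Sum>j=1..l. S j \<omega>) \<le> (\<Sum>j=1..m. S j \<omega>)" if "l \<le> m" for l m
    using that S_pos by (intro sum_mono2) (auto intro: less_imp_le)
  have "{l. (\<Sum>j=1..l. S j \<omega>) \<le> t} = {..k}"
  proof (intro set_eqI iffI)
    fix l assume "l \<in> {l. (\<Sum>j=1..l. S j \<omega>) \<le> t}"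
    thus "l \<in> {..k}"
      using mono[of "Suc k" l] assms(3) by (cases "Suc k \<le> l") auto
  next
    fix l assume "l \<in> {..k}"
    thus "l \<in> {l. (\<Sum>j=1..l. S j \<omega>) \<le> t}"
      using mono[of l k] assms(2) by auto
  qed
  thus ?thesis
    unfolding embed_index_def by (auto intro: Max_eqI)
qed

lemma partial_sums_bracket:
  fixes f :: "nat \<Rightarrow> real"
  assumes "0 \<le> t" "t < (\<Sum>j=1..n. f j)"
  shows "\<exists>k<n. (\<Sum>j=1..k. f j) \<le> t \<and> t < (\<Sum>j=1..Suc k. f j)"
  using assms(2)
proof (induction n)
  case 0
  thus ?case using assms(1) by simp
next
  case (Suc n)
  show ?case
  proof (cases "t < (\<Sum>j=1..n. f j)")
    case True
    with Suc.IH show ?thesis using less_SucI by blast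
  next
    case False
    with Suc.prems show ?thesis by (intro exI[of _ n]) auto
  qed
qed

text \<open>
  Each increasing piece of \<open>Y\<close> stays strictly below the next value of \<open>X\<close>, hence
  below \<open>b\<close> for the first \<open>m\<close> pieces. The piece that starts from \<open>lam X\<^sub>m - T\<^sub>m\<^sub>+\<^sub>1\<close> reaches \<open>b\<close> after time
  \<open>r\<close>, provided that it lasts that long.
\<close>
lemma tau_hat_embed_Y:
  fixes b lam x :: real and S T :: "nat \<Rightarrow> 'w \<Rightarrow> real" and \<omega> :: 'w
  defines "X \<equiv> AR_process lam x (\<lambda>k \<omega>. S k \<omega> - T k \<omega>)"
  assumes S_pos: "\<And>k. 1 \<le> k \<Longrightarrow> 0 < S k \<omega>"
    and below: "\<And>k. k \<le> m \<Longrightarrow> X k \<omega> < b"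
  defines "r \<equiv> b - lam * X m \<omega> + T (Suc m) \<omega>"
  assumes r: "0 < r" "r < S (Suc m) \<omega>"
  shows "tau_hat b (embed_Y lam X S T) \<omega> = ereal ((\<Sum>k=1..m. S k \<omega>) + r)"
    and "embed_J J S ((\<Sum>k=1..m. S k \<omega>) + r) \<omega> = J (Suc m) r \<omega>"
proof -
  define s where "s k = (\<Sum>j=1..k. S j \<omega>)" for k
  have index: "embed_index S t \<omega> = k" if "s k \<le> t" "t < s (Suc k)" for t k
    using S_pos that unfolding s_def by (rule embed_index_eq)
  have s_m: "0 \<le> s m" "s (Suc m) = s m + S (Suc m) \<omega>"
    using S_pos unfolding s_def by (auto intro!: sum_nonneg) (force intro: less_imp_le)
  have Y: "embed_Y lam X S T t \<omega> = lam * X k \<omega> - T (Suc k) \<omega> + t - s k"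
    if "s k \<le> t" "t < s (Suc k)" for t k
    using index[OF that] by (simp add: embed_Y_def s_def)
  have "embed_index S (s m + r) \<omega> = m"
    using r s_m by (intro index) auto
  thus "embed_J J S ((\<Sum>k=1..m. S k \<omega>) + r) \<omega> = J (Suc m) r \<omega>"
    by (simp add: embed_J_def s_def)
  have reached: "embed_Y lam X S T (s m + r) \<omega> = b"
    using Y[of m "s m + r"] r s_m by (simp add: r_def)
  have not_before: "embed_Y lam X S T t \<omega> < b" if t: "0 \<le> t" "t < s m + r" for t
  proof -
    have "t < s (Suc m)"
      using t(2) r(2) s_m(2) by simp
    then obtain k where k: "k < Suc m" "s k \<le> t" "t < s (Suc k)"
      using partial_sums_bracket[OF t(1)] unfolding s_def by blast
    show ?thesis
    proof (cases "k = m")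
      case True
      thus ?thesis using Y[OF k(2,3)] t by (simp add: r_def)
    next
      case False
      have "lam * X k \<omega> - T (Suc k) \<omega> + t - s k < lam * X k \<omega> - T (Suc k) \<omega> + S (Suc k) \<omega>"
        using k(3) by (simp add: s_def)
      also have "\<dots> = X (Suc k) \<omega>"
        by (simp add: X_def)
      also have "\<dots> < b"
        using k(1) False by (intro below) auto
      finally show ?thesis using Y[OF k(2,3)] by simp
    qed
  qed
  show "tau_hat b (embed_Y lam X S T) \<omega> = ereal ((\<Sum>k=1..m. S k \<omega>) + r)"
    unfolding tau_hat_def s_def[symmetric]
  proof (intro antisym Inf_lower Inf_greatest)
    show "ereal (s m + r) \<in> ereal ` {t. 0 \<le> t \<and> b \<le> embed_Y lam X S T t \<omega>}"
      using reached s_m r by auto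
    show "ereal (s m + r) \<le> z" if "z \<in> ereal ` {t. 0 \<le> t \<and> b \<le> embed_Y lam X S T t \<omega>}" for z
      using that not_before by (auto simp: not_less[symmetric])
  qed
qed

section \<open>Independence of the past\<close>

text \<open>
  A version of the absorption time that is measurable for the \<open>\<sigma>\<close>-algebra generated by the
  chain, since only countably many coordinates enter. On regular paths it agrees with the absorption time.
\<close>
definition rational_absorption_time :: "(real \<Rightarrow> 'w \<Rightarrow> 'm option) \<Rightarrow> 'w \<Rightarrow> real" where
  "rational_absorption_time J \<omega> =
     real_of_ereal (INF q\<in>{q\<in>\<rat>. 0 \<le> q}. if J q \<omega> = None then ereal q else \<infinity>)"

lemma borel_measurable_rational_absorption_time:
  assumes "\<And>t. 0 \<le> t \<Longrightarrow> J t \<in> measurable N (count_space UNIV)"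
  shows "rational_absorption_time J \<in> borel_measurable N"
proof -
  have "countable {q\<in>\<rat>. 0 \<le> (q::real)}"
    by (rule countable_subset[OF _ countable_rat]) auto
  moreover have "(\<lambda>\<omega>. if J q \<omega> = None then ereal q else \<infinity>) \<in> borel_measurable N" if "0 \<le> q" for q
  proof -
    note [measurable] = assms[OF that]
    show ?thesis by measurable
  qed
  ultimately have "(\<lambda>\<omega>. INF q\<in>{q\<in>\<rat>. 0 \<le> q}. if J q \<omega> = None then ereal q else \<infinity>) \<in> borel_measurable N"
    by (intro borel_measurable_INF) auto
  thus ?thesis
    unfolding rational_absorption_time_def by measurable
qed

lemma rational_absorption_time_eq:
  assumes "0 < s" and "\<And>t. 0 \<le> t \<Longrightarrow> J t \<omega> = None \<longleftrightarrow> s \<le> t"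
  shows "rational_absorption_time J \<omega> = s"
proof -
  let ?f = "\<lambda>q. if J q \<omega> = None then ereal q else \<infinity>"
  have "(INF q\<in>{q\<in>\<rat>. 0 \<le> q}. ?f q) = ereal s"
  proof (rule antisym)
    show "(INF q\<in>{q\<in>\<rat>. 0 \<le> q}. ?f q) \<le> ereal s"
    proof (rule ccontr)
      assume "\<not> ?thesis"
      then obtain z where z: "s < z" "ereal z < (INF q\<in>{q\<in>\<rat>. 0 \<le> q}. ?f q)"
        using ereal_dense2[of "ereal s"] by (auto simp: not_le)
      obtain q where q: "q \<in> \<rat>" "s < q" "q < z"
        using Rats_dense_in_real[OF z(1)] by auto
      hence "(INF q\<in>{q\<in>\<rat>. 0 \<le> q}. ?f q) \<le> ?f q"
        using assms(1) by (intro INF_lower) auto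
      also have "\<dots> < ereal z"
        using q assms by simp
      finally show False
        using z(2) by simp
    qed
    show "ereal s \<le> (INF q\<in>{q\<in>\<rat>. 0 \<le> q}. ?f q)"
      using assms by (intro INF_greatest) auto
  qed
  thus ?thesis
    by (simp add: rational_absorption_time_def)
qed

text \<open>
  The information that determines the process up to time \<open>n - 1\<close> together with \<open>T n\<close>, but not
  the \<open>n\<close>-th chain.
\<close>
definition past_sigma ::
  "'w measure \<Rightarrow> (nat \<Rightarrow> real \<Rightarrow> 'w \<Rightarrow> 's) \<Rightarrow> (nat \<Rightarrow> 'w \<Rightarrow> real) \<Rightarrow> nat \<Rightarrow> 'w measure" where
  "past_sigma M J T n =
     sigma (space M) (\<Union>k\<in>{1..<n} <+> {1..n}. generated_sigma M J T k)"

lemma generated_sigma_subset_Pow: "generated_sigma M J T k \<subseteq> Pow (space M)"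
proof (cases k)
  case (Inl n)
  have "sigma_sets (space M) {J n t -` {s} \<inter> space M | t s. 0 \<le> t} \<subseteq> Pow (space M)"
    by (rule sigma_sets_into_sp[THEN PowI, THEN subsetI]) auto
  thus ?thesis by (simp add: generated_sigma_def Inl)
next
  case (Inr n)
  thus ?thesis by (auto simp: generated_sigma_def)
qed

lemma space_past_sigma: "space (past_sigma M J T n) = space M"
  and sets_past_sigma: "sets (past_sigma M J T n) =
        sigma_sets (space M) (\<Union>k\<in>{1..<n} <+> {1..n}. generated_sigma M J T k)"
proof -
  have "(\<Union>k\<in>{1..<n} <+> {1..n}. generated_sigma M J T k) \<subseteq> Pow (space M)"
    using generated_sigma_subset_Pow by (rule UN_least)
  thus "space (past_sigma M J T n) = space M"
    and "sets (past_sigma M J T n) = sigma_sets (space M) (\<Union>k\<in>{1..<n} <+> {1..n}. generated_sigma M J T k)"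
    unfolding past_sigma_def by simp_all
qed

lemma measurable_past_sigma_chain:
  fixes J :: "nat \<Rightarrow> real \<Rightarrow> 'w \<Rightarrow> 's::finite"
  assumes "1 \<le> k" "k < n" "0 \<le> t"
  shows "J k t \<in> measurable (past_sigma M J T n) (count_space UNIV)"
proof (subst measurable_count_space_eq2, simp, intro conjI ballI)
  fix s
  have "J k t -` {s} \<inter> space M \<in> generated_sigma M J T (Inl k)"
    unfolding generated_sigma_def sum.case using assms(3) by (intro sigma_sets.Basic) blast
  moreover have "Inl k \<in> {1..<n} <+> {1..n}"
    using assms(1,2) by (intro InlI) simp
  ultimately show "J k t -` {s} \<inter> space (past_sigma M J T n) \<in> sets (past_sigma M J T n)"
    unfolding space_past_sigma sets_past_sigma by (rule sigma_sets.Basic[OF UN_I, rotated])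
qed simp

lemma measurable_past_sigma_T:
  assumes "1 \<le> k" "k \<le> n"
  shows "T k \<in> borel_measurable (past_sigma M J T n)"
proof (rule measurableI)
  fix B :: "real set" assume "B \<in> sets borel"
  hence "T k -` B \<inter> space M \<in> generated_sigma M J T (Inr k)"
    unfolding generated_sigma_def sum.case by blast
  moreover have "Inr k \<in> {1..<n} <+> {1..n}"
    using assms by (intro InrI) simp
  ultimately show "T k -` B \<inter> space (past_sigma M J T n) \<in> sets (past_sigma M J T n)"
    unfolding space_past_sigma sets_past_sigma by (rule sigma_sets.Basic[OF UN_I, rotated])
qed simp

lemma (in prob_space) indep_past_sigma:
  assumes indep: "indep_sets (generated_sigma M J T) ({1..} <+> {1..})" and n: "1 \<le> n"
  shows "indep_set (sets (past_sigma M J T n)) (chain_events M (J n))"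
proof -
  define K where "K = case_bool ({1..<n} <+> {1..n}) {Inl n :: nat + nat}"
  have stable: "Int_stable (generated_sigma M J T k)" for k
  proof (cases k)
    case (Inl n)
    interpret past: sigma_algebra "space M" "sigma_sets (space M) {J n t -` {s} \<inter> space M | t s. 0 \<le> t}"
      by (rule sigma_algebra_sigma_sets) auto
    show ?thesis
      unfolding Inl generated_sigma_def sum.case by (intro Int_stableI past.Int)
  next
    case (Inr n)
    show ?thesis
    proof (rule Int_stableI)
      fix A B assume "A \<in> generated_sigma M J T k" "B \<in> generated_sigma M J T k"
      then obtain A' B' where "A = T n -` A' \<inter> space M" "A' \<in> sets borel"
          "B = T n -` B' \<inter> space M" "B' \<in> sets borel"
        unfolding Inr generated_sigma_def by auto
      hence "A \<inter> B = T n -` (A' \<inter> B') \<inter> space M" "A' \<inter> B' \<in> sets borel"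
        by auto
      thus "A \<inter> B \<in> generated_sigma M J T k"
        unfolding Inr generated_sigma_def sum.case by blast
    qed
  qed
  have "indep_sets (\<lambda>j. sigma_sets (space M) (\<Union>k\<in>K j. generated_sigma M J T k)) UNIV"
  proof (rule indep_sets_collect_sigma)
    show "indep_sets (generated_sigma M J T) (\<Union>j\<in>UNIV. K j)"
      using n by (intro indep_sets_mono_index[OF _ indep]) (auto simp: K_def UNIV_bool)
    show "disjoint_family_on K UNIV"
      by (auto simp: disjoint_family_on_def K_def split: bool.splits)
  qed (rule stable)
  thus ?thesis
    unfolding indep_set_def
  proof (rule indep_sets_mono_sets)
    fix j
    show "case_bool (sets (past_sigma M J T n)) (chain_events M (J n)) j
          \<subseteq> sigma_sets (space M) (\<Union>k\<in>K j. generated_sigma M J T k)"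
      by (cases j) (auto simp: sets_past_sigma K_def generated_sigma_def intro: sigma_sets.Basic)
  qed
qed

section \<open>Phase at first passage and overshoot\<close>

theorem theorem2p5:
  fixes M :: "'w measure"
    and Q :: "real ^ 'm ^ 'm::finite"
    and \<alpha> :: "real ^ 'm"
    and J :: "nat \<Rightarrow> real \<Rightarrow> 'w \<Rightarrow> 'm option"
    and S T X :: "nat \<Rightarrow> 'w \<Rightarrow> real"
    and Jt :: "real \<Rightarrow> 'w \<Rightarrow> 'm option"
    and Y :: "real \<Rightarrow> 'w \<Rightarrow> real"
    and \<tau> :: "'w \<Rightarrow> enat"
    and G :: "'m \<Rightarrow> 'w set"
    and lam x b y :: real
    and n :: nat
  assumes "prob_space M"
    and "is_generator (Q_hat Q)"
    and "\<And>i. transient_state (Q_hat Q) (Some i)"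
    and "prob_vector \<alpha>"
    and "0 < lam" "lam < 1"
    and "\<And>k. 1 \<le> k \<Longrightarrow> markov_chain M (Q_hat Q) (init_ext \<alpha>) (J k)"
    and "\<And>k. 1 \<le> k \<Longrightarrow> T k \<in> borel_measurable M"
    and "\<And>k. 1 \<le> k \<Longrightarrow> AE \<omega> in M. 0 \<le> T k \<omega>"
    and "\<And>k. 1 \<le> k \<Longrightarrow> distr M borel (T k) = distr M borel (T 1)"
    and "prob_space.indep_sets M (generated_sigma M J T) ({1..} <+> {1..})"
    and S_def: "S = (\<lambda>k \<omega>. real_of_ereal (absorption_time (J k) \<omega>))"
    and X_def: "X = AR_process lam x (\<lambda>k \<omega>. S k \<omega> - T k \<omega>)"
    and Jt_def: "Jt = embed_J J S"
    and Y_def: "Y = embed_Y lam X S T"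
    and \<tau>_def: "\<tau> = hitting_time b X"
    and G_def: "G = G_event M b Y Jt"
    and "0 \<le> b" "x < b" "1 \<le> n" "0 \<le> y"
  shows "cprob M {\<omega> \<in> space M. X (the_enat (\<tau> \<omega>)) \<omega> - b \<le> y \<and> \<tau> \<omega> = enat n} =
         (\<Sum>i\<in>UNIV. PH_cdf Q (axis i 1) y * cprob M ({\<omega> \<in> space M. \<tau> \<omega> = enat n} \<inter> G i))"
proof -
  interpret prob_space M by fact
  interpret c: prob_space "completion M"
    by (rule prob_space_completion)
  note chain = assms(7)
  obtain m where n: "n = Suc m"
    using \<open>1 \<le> n\<close> by (cases n) auto
  define N where "N = past_sigma M J T n"
  \<comment> \<open>Versions of \<open>S\<close> and \<open>X\<close> that are measurable for the past exactly, and not only up to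
     null sets, as independence requires.\<close>
  define S' where "S' k = rational_absorption_time (J k)" for k
  define X' where "X' = AR_process lam x (\<lambda>k \<omega>. S' k \<omega> - T k \<omega>)"
  define R where "R \<omega> = b - lam * X' m \<omega> + T n \<omega>" for \<omega>
  \<comment> \<open>The condition \<open>0 < R \<omega>\<close> follows almost surely from the other one. It is included because the
     Markov property at time \<open>R\<close> needs \<open>R\<close> to be nonnegative on the whole event.\<close>
  define F where "F = {\<omega> \<in> space N. 0 < R \<omega> \<and> (\<forall>k<n. X' k \<omega> < b)}"
  define B where "B i = {\<omega> \<in> F. J n (R \<omega>) \<omega> = Some i \<and> J n (R \<omega> + y) \<omega> = None}" for i
  have space_N: "space N = space M"
    by (simp add: N_def space_past_sigma)
  have indep: "indep_set (sets N) (chain_events M (J n))"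
    unfolding N_def using \<open>indep_sets _ _\<close> \<open>1 \<le> n\<close> by (rule indep_past_sigma)
  have T_meas: "T k \<in> borel_measurable N" if "1 \<le> k" "k \<le> n" for k
    unfolding N_def using that by (rule measurable_past_sigma_T)
  have S'_meas: "S' k \<in> borel_measurable N" if "1 \<le> k" "k < n" for k
    unfolding S'_def N_def
    by (rule borel_measurable_rational_absorption_time[OF measurable_past_sigma_chain[OF that]])
  have X'_meas: "X' k \<in> borel_measurable N" if "k < n" for k
    using that
  proof (induction k)
    case 0
    show ?case unfolding X'_def AR_process.simps by (rule borel_measurable_const)
  next
    case (Suc k)
    have "X' k \<in> borel_measurable N" "S' (Suc k) \<in> borel_measurable N" "T (Suc k) \<in> borel_measurable N"
      using Suc by (auto intro: S'_meas T_meas)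
    note [measurable] = this
    have "X' (Suc k) = (\<lambda>\<omega>. lam * X' k \<omega> + (S' (Suc k) \<omega> - T (Suc k) \<omega>))"
      by (simp add: X'_def)
    thus ?case
      by (simp only:) measurable
  qed
  have R_meas: "R \<in> borel_measurable N"
  proof -
    have "X' m \<in> borel_measurable N" "T n \<in> borel_measurable N"
      using n by (auto intro: X'_meas T_meas)
    note [measurable] = this
    show ?thesis
      unfolding R_def by measurable
  qed
  have F_N: "F \<in> sets N"
  proof -
    note [measurable] = X'_meas R_meas
    show ?thesis
      unfolding F_def by measurable
  qed
  have F_space: "F \<subseteq> space M"
    by (auto simp: F_def space_N)
  have R_nonneg: "0 \<le> R \<omega>" if "\<omega> \<in> F" for \<omega>
    using that by (simp add: F_def)
  note at_time = chain_at_independent_time[OF chain[OF \<open>1 \<le> n\<close>] space_N indep R_meas F_N R_nonneg \<open>0 \<le> y\<close>]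

  have absorption: "AE \<omega> in M. 0 < S k \<omega> \<and> (\<forall>t\<ge>0. J k t \<omega> = None \<longleftrightarrow> S k \<omega> \<le> t)" if "1 \<le> k" for k
    unfolding S_def using assms(1-3) chain[OF that] by (rule AE_absorption)
  have "AE \<omega> in M. \<forall>k\<in>{1..}. 0 \<le> T k \<omega> \<and> 0 < S k \<omega> \<and> (\<forall>t\<ge>0. J k t \<omega> = None \<longleftrightarrow> S k \<omega> \<le> t)"
    using absorption assms(9) by (subst AE_ball_countable) auto
  moreover have "AE \<omega> in M. 0 < R \<omega> \<longrightarrow> S n \<omega> \<noteq> R \<omega>"
    by (rule absorption_not_at_independent_time[OF chain[OF \<open>1 \<le> n\<close>] space_N indep R_meas])
       (use absorption[OF \<open>1 \<le> n\<close>] in eventually_elim, simp)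
  ultimately have main: "AE \<omega> in M.
      (X (the_enat (\<tau> \<omega>)) \<omega> - b \<le> y \<and> \<tau> \<omega> = enat n \<longleftrightarrow> (\<exists>i. \<omega> \<in> B i)) \<and>
      (\<forall>i. \<tau> \<omega> = enat n \<and> \<omega> \<in> G i \<longleftrightarrow> \<omega> \<in> F \<and> J n (R \<omega>) \<omega> = Some i)"
    using AE_space
  proof eventually_elim
    case (elim \<omega>)
    have pos: "0 < S k \<omega>" and T: "0 \<le> T k \<omega>"
      and None_iff: "\<And>t. 0 \<le> t \<Longrightarrow> J k t \<omega> = None \<longleftrightarrow> S k \<omega> \<le> t" if "1 \<le> k" for k
      using elim(1) that by auto
    have "S' k \<omega> = S k \<omega>" if "1 \<le> k" for k
      unfolding S'_def using pos[OF that] None_iff[OF that] by (rule rational_absorption_time_eq)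
    hence X': "X' k \<omega> = X k \<omega>" for k
      unfolding X'_def X_def by (induction k) auto
    have R: "R \<omega> = b - lam * X m \<omega> + T (Suc m) \<omega>"
      by (simp add: R_def X' n)
    have Xn: "X n \<omega> = b + (S n \<omega> - R \<omega>)"
      by (simp add: R n X_def)
    have R_pos: "0 < R \<omega>" if "X m \<omega> < b"
    proof -
      have "lam * X m \<omega> < lam * b"
        using that \<open>0 < lam\<close> by simp
      also have "\<dots> \<le> b"
        using \<open>lam < 1\<close> \<open>0 \<le> b\<close> by (simp add: mult_left_le_one_le \<open>0 < lam\<close> less_imp_le)
      finally show ?thesis
        using T[of "Suc m"] by (simp add: R)
    qed
    have F: "\<omega> \<in> F \<longleftrightarrow> (\<forall>k<n. X k \<omega> < b)"
      using R_pos elim(3) n by (auto simp: F_def X' space_N)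
    have \<tau>: "\<tau> \<omega> = enat n \<longleftrightarrow> \<omega> \<in> F \<and> R \<omega> < S n \<omega>"
      using elim(2) unfolding \<tau>_def hitting_time_eq_enat_iff F Xn
      using R_pos n by auto
    have alive: "J n t \<omega> = None \<longleftrightarrow> S n \<omega> \<le> t" if "0 \<le> t" for t
      using None_iff[OF \<open>1 \<le> n\<close> that] .
    have "X (the_enat (\<tau> \<omega>)) \<omega> - b \<le> y \<and> \<tau> \<omega> = enat n \<longleftrightarrow> \<omega> \<in> F \<and> R \<omega> < S n \<omega> \<and> S n \<omega> \<le> R \<omega> + y"
      using Xn \<tau> by auto
    also have "\<dots> \<longleftrightarrow> (\<exists>i. \<omega> \<in> B i)"
      using alive[of "R \<omega>"] alive[of "R \<omega> + y"] \<open>0 \<le> y\<close> R_nonneg[of \<omega>] unfolding B_def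
      by (auto simp: not_le[symmetric])
    finally have 1: "X (the_enat (\<tau> \<omega>)) \<omega> - b \<le> y \<and> \<tau> \<omega> = enat n \<longleftrightarrow> (\<exists>i. \<omega> \<in> B i)" .
    have 2: "\<tau> \<omega> = enat n \<and> \<omega> \<in> G i \<longleftrightarrow> \<omega> \<in> F \<and> J n (R \<omega>) \<omega> = Some i" for i
    proof (cases "\<tau> \<omega> = enat n")
      case True
      hence *: "\<omega> \<in> F" "R \<omega> < S n \<omega>"
        using \<tau> by auto
      have below: "AR_process lam x (\<lambda>k \<omega>. S k \<omega> - T k \<omega>) k \<omega> < b" if "k \<le> m" for k
        using *(1) that n unfolding F X_def by auto
      have "0 < R \<omega>"
        using *(1) by (simp add: F_def)
      hence r: "0 < b - lam * AR_process lam x (\<lambda>k \<omega>. S k \<omega> - T k \<omega>) m \<omega> + T (Suc m) \<omega>"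
        "b - lam * AR_process lam x (\<lambda>k \<omega>. S k \<omega> - T k \<omega>) m \<omega> + T (Suc m) \<omega> < S (Suc m) \<omega>"
        using *(2) n by (simp_all add: R X_def)
      have "tau_hat b Y \<omega> = ereal ((\<Sum>k=1..m. S k \<omega>) + R \<omega>)"
        unfolding Y_def X_def R by (rule tau_hat_embed_Y(1)[OF pos below r])
      moreover have "Jt ((\<Sum>k=1..m. S k \<omega>) + R \<omega>) \<omega> = J n (R \<omega>) \<omega>"
        unfolding Jt_def X_def R n by (rule tau_hat_embed_Y(2)[OF pos below r])
      ultimately show ?thesis
        using True *(1) elim(3) by (simp add: G_def G_event_def)
    next
      case False
      thus ?thesis
        using \<tau> alive[of "R \<omega>"] R_nonneg[of \<omega>] by auto
    qed
    from 1 2 show ?case by blast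
  qed

  have B_sets: "B i \<in> sets (completion M)" for i
    unfolding B_def by (rule at_time(1)[where P = "\<lambda>a b. a = Some i \<and> b = None"])
  have G: "cprob M ({\<omega> \<in> space M. \<tau> \<omega> = enat n} \<inter> G i) = cprob M {\<omega> \<in> F. J n (R \<omega>) \<omega> = Some i}" for i
  proof (rule cprob_cong_AE)
    show "{\<omega> \<in> F. J n (R \<omega>) \<omega> = Some i} \<in> sets (completion M)"
      by (rule at_time(1)[where P = "\<lambda>a b. a = Some i"])
    show "AE \<omega> in M. \<omega> \<in> {\<omega> \<in> space M. \<tau> \<omega> = enat n} \<inter> G i \<longleftrightarrow> \<omega> \<in> {\<omega> \<in> F. J n (R \<omega>) \<omega> = Some i}"
      using main AE_space by eventually_elim auto
  qed auto
  have "cprob M {\<omega> \<in> space M. X (the_enat (\<tau> \<omega>)) \<omega> - b \<le> y \<and> \<tau> \<omega> = enat n} = cprob M (\<Union>i. B i)"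
  proof (rule cprob_cong_AE)
    show "(\<Union>i. B i) \<in> sets (completion M)"
      using B_sets by auto
    show "AE \<omega> in M. \<omega> \<in> {\<omega> \<in> space M. X (the_enat (\<tau> \<omega>)) \<omega> - b \<le> y \<and> \<tau> \<omega> = enat n} \<longleftrightarrow> \<omega> \<in> (\<Union>i. B i)"
      using main AE_space by eventually_elim auto
  qed auto
  also have "\<dots> = (\<Sum>i\<in>UNIV. cprob M (B i))"
    using B_sets by (intro c.finite_measure_finite_Union) (auto simp: disjoint_family_on_def B_def)
  also have "\<dots> = (\<Sum>i\<in>UNIV. PH_cdf Q (axis i 1) y * cprob M ({\<omega> \<in> space M. \<tau> \<omega> = enat n} \<inter> G i))"
    unfolding B_def G PH_cdf_unit[OF \<open>0 \<le> y\<close>] by (subst at_time(2), assumption) (rule sum.cong[OF refl mult.commute])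
  finally show ?thesis .
qed

end
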